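(* Let $I$ be a financial instrument with multiplier $m_I>0$ and price process $\{P(t)\}_{t\in T}$ satisfying the standing assumptions on the price process given in the context. Let $S$ be any trading strategy on $I$, satisfying the standing assumptions on strategies given in the context, that does not use its self-generated historical trading information (HTI) to probabilistically influence its new orders. Then there exists a trading strategy $S^*$ on $I$, running simultaneously with $S$ on the same price process, that uses its own self-generated HTI and is such that $$\mathrm{Prob}\left(\left\{\lim_{t\to\infty}\bigl(PnL_{S^*}(t)-PnL_S(t)\bigr)=\infty\right\}\right)=1 .$$
   Context: **Price process.** $T$ is a discrete set of times, unbounded above (e.g. $T=\mathbb{N}$). $\{P(t)\}_{t\in T}$ is a stochastic process with values in a finite set of positive prices, all integer multiples of a fixed tick size (the "finite tick grid"). $\mathbb{E}_s$ is a suitable subset of this grid, in which strategies submit and execute orders. The following recurrence properties are assumed. For every time $t$, every $p\in\mathbb{E}_s$ with $\mathrm{Prob}(P(t)=p)>0$, and all positive thresholds $\xi_t,\varsigma_t$ such that all the involved prices are in $\mathbb{E}_s$, $$\mathrm{Prob}\bigl(\exists\,0<u<\infty:\ P(t+u)>p+\xi_t \,\big|\, P(t)=p\bigr)=1,$$ $$\mathrm{Prob}\bigl(\exists\,0<v<\infty:\ P(t+v)<p-\varsigma_t \,\big|\, P(t)=p\bigr)=1,$$ and these passages beyond the threshold occur in finite expected time. Here "all the involved prices are in $\mathbb{E}_s$" means, for the first property, that $p$ and $p+\xi_t$ are in $\mathbb{E}_s$, that $\mathbb{E}_s$ contains a price strictly above $p+\xi_t$, and that the price $P(t+u)$ beyond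 the threshold is in $\mathbb{E}_s$; and symmetrically (with $p-\varsigma_t$ and "below") for the second. "Suitable" means that from every $p\in\mathbb{E}_s$ at least one such threshold, above or below, is available. **Strategies and orders.** A trading strategy is a set of rules (deterministic or randomized) generating orders over time in response to the price trajectory and possibly other available market data, and possibly also to its own past filled orders. The orders filled by a strategy up to and including time $t$ are $o_1,\dots,o_{n(t)}$ with $o_h=(t_h,s_h,p_h,q_h)$, where $t_h\le t$ is the fill time, $s_h=1$ for a sell order and $s_h=-1$ for a buy order, $p_h=P(t_h)$ is the fill price, and $q_h>0$ is the filled quantity. The bid/ask spread is taken to be zero, and commissions and other trading expenses are ignored. The open position may be positive or negative (short selling is allowed). Standing assumptions on strategies: they are carried out continuously over the infinite time horizon, execute their orders at prices in $\mathbb{E}_s$, and have at least one fill. **Profit and loss.** For a strategy $S$ whose filled orders up to and including time $t$ are $o_h=(t_h,s_h,p_h,q_h)$, $h=1,\dots,n(t)$, $$PnL_S(t)=m_I\sum_{h=1}^{n(t)} s_h\,(p_h-P(t))\,q_h .$$ **Historical trading information.** $HTI(t)$ of a strategy is the information consisting of its own filled orders up to time $t$. A strategy does not use its self-generated HTI if its new orders do not depend probabilistically on it: for every order, the probability that it is executed at time $t$ when $HTI(t)$ is taken into account equals the probability that it is executed at time $t$ when $HTI(t)$ is disregarded. In terms of rules: the (possibly randomized) rule producing new orders at time $t$, viewed as a function of the market data up to $t$ and of the strategy's own $HTI(t)$, does not depend on the argument $HTI(t)$. A strategy uses its own HTI if its rule does depend on this argument. *)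

theory Defs
  imports "HOL-Probability.Probability"
begin

section \<open>Price process\<close>

(* For real times, "discrete" is read as "finitely many times in every bounded interval". *)
definition trading_times :: "real set \<Rightarrow> bool" where
  "trading_times T \<longleftrightarrow> (\<forall>a b. finite (T \<inter> {a..b})) \<and> \<not> bdd_above T"

(* F t is the market data available up to time t: it contains the price trajectory up to t, and
   possibly further data. *)
definition market_data ::
    "'w measure \<Rightarrow> real set \<Rightarrow> (real \<Rightarrow> 'w measure) \<Rightarrow> (real \<Rightarrow> 'w \<Rightarrow> real) \<Rightarrow> bool" where
  "market_data M T F P \<longleftrightarrow>
     (\<forall>t\<in>T. subalgebra M (F t)) \<and>
     (\<forall>s\<in>T. \<forall>t\<in>T. s \<le> t \<longrightarrow> sets (F s) \<subseteq> sets (F t)) \<and>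
     (\<forall>t\<in>T. P t \<in> borel_measurable (F t))"

definition tick_grid :: "real \<Rightarrow> real set \<Rightarrow> bool" where
  "tick_grid \<delta> \<Gamma> \<longleftrightarrow> \<delta> > 0 \<and> finite \<Gamma> \<and> (\<forall>x\<in>\<Gamma>. x > 0 \<and> (\<exists>k::int. x = of_int k * \<delta>))"

definition up_threshold :: "real set \<Rightarrow> real \<Rightarrow> real \<Rightarrow> bool" where
  "up_threshold E p \<xi> \<longleftrightarrow> \<xi> > 0 \<and> p \<in> E \<and> p + \<xi> \<in> E \<and> (\<exists>x\<in>E. x > p + \<xi>)"

definition down_threshold :: "real set \<Rightarrow> real \<Rightarrow> real \<Rightarrow> bool" where
  "down_threshold E p \<zeta> \<longleftrightarrow> \<zeta> > 0 \<and> p \<in> E \<and> p - \<zeta> \<in> E \<and> (\<exists>x\<in>E. x < p - \<zeta>)"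

(* The waiting times u > 0 after t at which the price satisfies Q and lies in E. *)
definition passages ::
    "real set \<Rightarrow> (real \<Rightarrow> 'w \<Rightarrow> real) \<Rightarrow> real set \<Rightarrow> real \<Rightarrow> (real \<Rightarrow> bool) \<Rightarrow> 'w \<Rightarrow> real set" where
  "passages T P E t Q \<omega> = {u. 0 < u \<and> t + u \<in> T \<and> Q (P (t + u) \<omega>) \<and> P (t + u) \<omega> \<in> E}"

(* Given P t = p, a passage occurs with probability 1 and the first one has finite expected
   waiting time; the infimum of the empty set is infinite in ennreal. *)
definition recurrent_passage ::
    "'w measure \<Rightarrow> real set \<Rightarrow> (real \<Rightarrow> 'w \<Rightarrow> real) \<Rightarrow> real set \<Rightarrow> real \<Rightarrow> real \<Rightarrow> (real \<Rightarrow> bool) \<Rightarrow> bool" where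
  "recurrent_passage M T P E t p Q \<longleftrightarrow>
     \<P>(\<omega> in M. (\<exists>u. u \<in> passages T P E t Q \<omega>) \<bar> P t \<omega> = p) = 1 \<and>
     (\<integral>\<^sup>+ \<omega>. (INF u\<in>passages T P E t Q \<omega>. ennreal u)
        \<partial>uniform_measure M {\<omega> \<in> space M. P t \<omega> = p}) < \<infinity>"

definition price_process ::
    "'w measure \<Rightarrow> real set \<Rightarrow> (real \<Rightarrow> 'w \<Rightarrow> real) \<Rightarrow> real set \<Rightarrow> real set \<Rightarrow> bool" where
  "price_process M T P \<Gamma> E \<longleftrightarrow>
     (\<forall>t\<in>T. P t \<in> borel_measurable M) \<and>
     (\<forall>t\<in>T. \<forall>\<omega>\<in>space M. P t \<omega> \<in> \<Gamma>) \<and>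
     E \<subseteq> \<Gamma> \<and>
     (\<forall>p\<in>E. (\<exists>\<xi>. up_threshold E p \<xi>) \<or> (\<exists>\<zeta>. down_threshold E p \<zeta>)) \<and>
     (\<forall>t\<in>T. \<forall>p\<in>E. \<P>(\<omega> in M. P t \<omega> = p) > 0 \<longrightarrow>
        (\<forall>\<xi>. up_threshold E p \<xi> \<longrightarrow> recurrent_passage M T P E t p (\<lambda>x. x > p + \<xi>)) \<and>
        (\<forall>\<zeta>. down_threshold E p \<zeta> \<longrightarrow> recurrent_passage M T P E t p (\<lambda>x. x < p - \<zeta>)))"


section \<open>Orders and profit and loss\<close>

(* An order (s, q) executed at time t is recorded as the filled order (t, s, P t, q). *)
type_synonym order = "int \<times> real"
type_synonym filled_order = "real \<times> int \<times> real \<times> real"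

(* Finite sequences in N, with the disjoint union of the product sigma-algebras of all lengths. *)
definition list_space :: "'a measure \<Rightarrow> 'a list measure" where
  "list_space N = sigma (lists (space N)) (listset ` lists (sets N))"

definition order_space :: "order measure" where
  "order_space = count_space {1, -1} \<Otimes>\<^sub>M restrict_space borel {0<..}"

definition filled_order_space :: "filled_order measure" where
  "filled_order_space =
     borel \<Otimes>\<^sub>M (count_space {1, -1} \<Otimes>\<^sub>M (borel \<Otimes>\<^sub>M restrict_space borel {0<..}))"

(* X t \<omega> lists the orders executed at time t. The filled orders with fill time in A are meaningful
   when only finitely many times in A carry an execution. *)
definition filled_orders ::
    "(real \<Rightarrow> 'w \<Rightarrow> real) \<Rightarrow> (real \<Rightarrow> 'w \<Rightarrow> order list) \<Rightarrow> real set \<Rightarrow> 'w \<Rightarrow> filled_order list" where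
  "filled_orders P X A \<omega> =
     concat (map (\<lambda>t. map (\<lambda>(s, q). (t, s, P t \<omega>, q)) (X t \<omega>))
       (sorted_list_of_set {t \<in> A. X t \<omega> \<noteq> []}))"

definition PnL ::
    "real \<Rightarrow> real set \<Rightarrow> (real \<Rightarrow> 'w \<Rightarrow> real) \<Rightarrow> (real \<Rightarrow> 'w \<Rightarrow> order list) \<Rightarrow> real \<Rightarrow> 'w \<Rightarrow> real" where
  "PnL m T P X t \<omega> =
     m * (\<Sum>(u, s, p, q) \<leftarrow> filled_orders P X {u \<in> T. u \<le> t} \<omega>. of_int s * (p - P t \<omega>) * q)"


section \<open>Strategies and their historical trading information\<close>

(* The information on which the orders executed at time t are based contains the fills strictly
   before t: the fills at t are the outcome of the rule at t. *)
definition HTI ::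
    "real set \<Rightarrow> (real \<Rightarrow> 'w \<Rightarrow> real) \<Rightarrow> (real \<Rightarrow> 'w \<Rightarrow> order list) \<Rightarrow> real \<Rightarrow> 'w \<Rightarrow> filled_order list" where
  "HTI T P X t \<omega> = filled_orders P X {u \<in> T. u < t} \<omega>"

(* K t \<omega> h is the law of the orders executed at time t, given the market data up to t and
   HTI h. A deterministic rule is a kernel of point masses. *)
type_synonym 'w rule = "real \<Rightarrow> 'w \<Rightarrow> filled_order list \<Rightarrow> order list measure"

definition trading_rule :: "real set \<Rightarrow> (real \<Rightarrow> 'w measure) \<Rightarrow> 'w rule \<Rightarrow> bool" where
  "trading_rule T F K \<longleftrightarrow>
     (\<forall>t\<in>T. (\<lambda>(\<omega>, h). K t \<omega> h)
        \<in> F t \<Otimes>\<^sub>M list_space filled_order_space \<rightarrow>\<^sub>M prob_algebra (list_space order_space))"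

(* Generated by the market data of all times and the strategy's executions before t. *)
definition conditioning_algebra ::
    "'w measure \<Rightarrow> real set \<Rightarrow> (real \<Rightarrow> 'w measure) \<Rightarrow> (real \<Rightarrow> 'w \<Rightarrow> order list) \<Rightarrow> real \<Rightarrow> 'w measure" where
  "conditioning_algebra M T F X t =
     sigma (space M)
       ((\<Union>s\<in>T. sets (F s)) \<union>
        {X u -` B \<inter> space M | u B. u \<in> T \<and> u < t \<and> B \<in> sets (list_space order_space)})"

(* X is an execution of the rule K. Conditioning on the market data of all times, although K t only
   sees those up to t, says that the randomization in the orders at t does not anticipate the
   future of the market. *)
definition executes ::
    "'w measure \<Rightarrow> real set \<Rightarrow> (real \<Rightarrow> 'w measure) \<Rightarrow> (real \<Rightarrow> 'w \<Rightarrow> real) \<Rightarrow>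
     'w rule \<Rightarrow> (real \<Rightarrow> 'w \<Rightarrow> order list) \<Rightarrow> bool" where
  "executes M T F P K X \<longleftrightarrow>
     (\<forall>t\<in>T. X t \<in> M \<rightarrow>\<^sub>M list_space order_space) \<and>
     (\<forall>t\<in>T. \<forall>\<omega>\<in>space M. finite {u \<in> T. u \<le> t \<and> X u \<omega> \<noteq> []}) \<and>
     (\<forall>t\<in>T. \<forall>B\<in>sets (list_space order_space). AE \<omega> in M.
        real_cond_exp M (conditioning_algebra M T F X t) (indicator (X t -` B \<inter> space M)) \<omega>
          = measure (K t \<omega> (HTI T P X t \<omega>)) B)"

definition trading_strategy ::
    "'w measure \<Rightarrow> real set \<Rightarrow> (real \<Rightarrow> 'w measure) \<Rightarrow> (real \<Rightarrow> 'w \<Rightarrow> real) \<Rightarrow> real set \<Rightarrow>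
     'w rule \<Rightarrow> (real \<Rightarrow> 'w \<Rightarrow> order list) \<Rightarrow> bool" where
  "trading_strategy M T F P E K X \<longleftrightarrow>
     trading_rule T F K \<and>
     executes M T F P K X \<and>
     (\<forall>t\<in>T. \<forall>\<omega>\<in>space M. X t \<omega> \<noteq> [] \<longrightarrow> P t \<omega> \<in> E) \<and>
     (AE \<omega> in M. \<exists>t\<in>T. X t \<omega> \<noteq> [])"

(* The lists of filled orders that can serve as HTI at time t on the price trajectory of \<omega>. *)
definition possible_HTI ::
    "real set \<Rightarrow> (real \<Rightarrow> 'w \<Rightarrow> real) \<Rightarrow> real set \<Rightarrow> real \<Rightarrow> 'w \<Rightarrow> filled_order list set" where
  "possible_HTI T P E t \<omega> =
     {h. sorted (map fst h) \<and>
         (\<forall>(u, s, p, q)\<in>set h.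
            u \<in> T \<and> u < t \<and> s \<in> {1, -1} \<and> p = P u \<omega> \<and> p \<in> E \<and> q > 0)}"

(* The HTI argument ranges over possible HTIs only, so that a dependence on meaningless
   arguments does not count as using the HTI. *)
definition uses_HTI ::
    "'w measure \<Rightarrow> real set \<Rightarrow> (real \<Rightarrow> 'w \<Rightarrow> real) \<Rightarrow> real set \<Rightarrow> 'w rule \<Rightarrow> bool" where
  "uses_HTI M T P E K \<longleftrightarrow>
     \<not> (\<forall>t\<in>T. AE \<omega> in M.
          \<forall>h\<in>possible_HTI T P E t \<omega>. \<forall>h'\<in>possible_HTI T P E t \<omega>. K t \<omega> h = K t \<omega> h')"

end

theory Submission
  imports Defs
begin

text \<open>Let \<open>a\<close> and \<open>b\<close> be the extreme prices of \<^term>\<open>E\<close>. With thresholds at the second highest and second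
  lowest prices, recurrence forces the price to visit both \<open>a\<close> and \<open>b\<close> infinitely often. To the orders
  of \<^term>\<open>S\<close> add the purchase of one unit at \<open>a\<close> whenever no such unit is held, and its sale at the next
  visit to \<open>b\<close>; whether a unit is held is read off the strategy's own fill times. Along its own fills
  this trade coincides with one determined by the market data alone, so the orders of \<^term>\<open>S\<close> keep their
  conditional law. Each completed cycle earns \<open>b - a\<close>, and the loss on the open unit is bounded by \<open>a\<close>.\<close>

subsection \<open>Buying at one price and selling at another\<close>

text \<open>A passage beyond a threshold determines the price reached only when a single price of
  \<open>E\<close> lies beyond it; the assumptions allow intermediate prices to be jumped over, so
  the trade relies on the extremes only. The obstacle is \<open>executes\<close>: the orders at
  \<open>t\<close> must follow the new rule evaluated at the fills of the combined strategy, where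
  the orders of the original strategy are mixed with the added ones and a unit order of either looks
  the same. Hence \<open>holding\<close> depends on a bare set of times: on a finite set it asks
  whether the last visit to \<open>a\<close> or \<open>b\<close> was to \<open>a\<close>, ignoring
  signs and quantities. Its value is the same for every set between the trade times and all observed
  times, so foreign fills cannot falsify it. Using the HTI is a property of the rule over all
  possible HTIs. The agreement with a market-determined trade along the actual fills therefore does
  not conflict with it.\<close>

definition holding :: "real \<Rightarrow> real \<Rightarrow> (real \<Rightarrow> real) \<Rightarrow> real set \<Rightarrow> bool" where
  "holding a b p A \<longleftrightarrow> (\<exists>u\<in>A. p u = a \<and> (\<forall>v\<in>A. u < v \<longrightarrow> p v \<noteq> b))"

definition trade_sign :: "real \<Rightarrow> real \<Rightarrow> (real \<Rightarrow> real) \<Rightarrow> real set \<Rightarrow> real \<Rightarrow> int" where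
  "trade_sign a b p A t =
     (if p t = a \<and> \<not> holding a b p A then -1 else if p t = b \<and> holding a b p A then 1 else 0)"

text \<open>The extra order is put in front, so measurability reduces to prepending a fixed
  order.\<close>

definition add_order :: "int \<Rightarrow> order list \<Rightarrow> order list" where
  "add_order d xs = (if d = 1 then (1, 1) # xs else if d = -1 then (-1, 1) # xs else xs)"

lemma trade_sign_cases: "trade_sign a b p A t \<in> {-1, 0, 1}"
  by (simp add: trade_sign_def)

lemma finite_earliest:
  fixes A :: "real set"
  assumes "finite A" "u \<in> A" "Q u"
  obtains w where "w \<in> A" "Q w" "w \<le> u" "\<And>v. v \<in> A \<Longrightarrow> Q v \<Longrightarrow> w \<le> v"
proof -
  let ?w = "Min {v \<in> A. Q v}"
  have "?w \<in> {v \<in> A. Q v}" by (rule Min_in) (use assms in auto)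
  moreover have "?w \<le> v" if "v \<in> A" "Q v" for v
    by (rule Min_le) (use that assms in auto)
  ultimately show thesis using that assms(2,3) by blast
qed

text \<open>Times without a trade are irrelevant, so the position can be read off the fill times.\<close>

lemma holding_trade_times:
  assumes ab: "a \<noteq> b" and fin: "finite A" and sub: "A' \<subseteq> A"
    and fills: "\<And>u. u \<in> A \<Longrightarrow> trade_sign a b p (A \<inter> {..<u}) u \<noteq> 0 \<Longrightarrow> u \<in> A'"
  shows "holding a b p A' \<longleftrightarrow> holding a b p A"
proof
  assume "holding a b p A"
  then obtain u where u: "u \<in> A" "p u = a \<and> (\<forall>v\<in>A. u < v \<longrightarrow> p v \<noteq> b)"
    unfolding holding_def by blast
  define Q where "Q u \<longleftrightarrow> p u = a \<and> (\<forall>v\<in>A. u < v \<longrightarrow> p v \<noteq> b)" for u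
  have "Q u" using u(2) by (simp add: Q_def)
  then obtain w where wA: "w \<in> A" and wQ: "Q w" and first: "\<And>v. v \<in> A \<Longrightarrow> Q v \<Longrightarrow> w \<le> v"
    using finite_earliest[OF fin u(1)] by metis
  from wA wQ have w: "w \<in> A" "p w = a" "\<forall>v\<in>A. w < v \<longrightarrow> p v \<noteq> b" by (auto simp: Q_def)
  \<comment> \<open>The earliest visit to \<open>a\<close> with no \<open>b\<close> afterwards is a
    purchase: a unit already held just before \<open>w\<close> would come from an earlier visit to
    \<open>a\<close>, also with no \<open>b\<close> afterwards because the price at \<open>w\<close>
    is \<open>a\<close>, against the choice of \<open>w\<close>.\<close>
  have "\<not> holding a b p (A \<inter> {..<w})"
  proof
    assume "holding a b p (A \<inter> {..<w})"
    then obtain v where v: "v \<in> A" "v < w" "p v = a" "\<forall>x\<in>A. x < w \<longrightarrow> v < x \<longrightarrow> p x \<noteq> b"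
      unfolding holding_def by auto
    then have "\<forall>x\<in>A. v < x \<longrightarrow> p x \<noteq> b"
      using w ab by (metis linorder_neqE_linordered_idom)
    then have "w \<le> v" using first[of v] v by (simp add: Q_def)
    then show False using v by simp
  qed
  then have "w \<in> A'" using w by (intro fills) (auto simp: trade_sign_def)
  then show "holding a b p A'" unfolding holding_def using w sub by blast
next
  assume "holding a b p A'"
  then obtain u where u: "u \<in> A'" "p u = a" "\<forall>v\<in>A'. u < v \<longrightarrow> p v \<noteq> b"
    unfolding holding_def by blast
  have "p v \<noteq> b" if v: "v \<in> A" "u < v" for v
  proof
    assume "p v = b"
    define Q where "Q v \<longleftrightarrow> u < v \<and> p v = b" for v
    have "Q v" using v(2) \<open>p v = b\<close> by (simp add: Q_def)
    then obtain w where wA: "w \<in> A" and wQ: "Q w" and min: "\<And>v. v \<in> A \<Longrightarrow> Q v \<Longrightarrow> w \<le> v"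
      using finite_earliest[OF fin v(1)] by metis
    have w: "w \<in> A" "u < w" "p w = b" using wA wQ by (auto simp: Q_def)
    have first: "p x \<noteq> b" if "x \<in> A" "u < x" "x < w" for x
      using min[of x] that by (auto simp: Q_def)
    \<comment> \<open>The first visit to \<open>b\<close> after \<open>u\<close> meets an open
      position, so it is a sale and belongs to \<open>A'\<close>, although \<open>u\<close> has no
      visit to \<open>b\<close> after it in \<open>A'\<close>.\<close>
    have "holding a b p (A \<inter> {..<w})"
      unfolding holding_def by (rule bexI[of _ u]) (use u w sub first in auto)
    then have "w \<in> A'" using w ab by (intro fills) (auto simp: trade_sign_def)
    then show False using u w by blast
  qed
  then show "holding a b p A" unfolding holding_def using u sub by blast
qed

definition sale_times :: "real \<Rightarrow> real \<Rightarrow> (real \<Rightarrow> real) \<Rightarrow> real set \<Rightarrow> real set" where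
  "sale_times a b p A = {u \<in> A. p u = b \<and> holding a b p (A \<inter> {..<u})}"

text \<open>Makes the position a two-state recursion in time, as needed for induction on the latest
  time.\<close>

lemma holding_insert:
  assumes "a \<noteq> b" "\<And>u. u \<in> A \<Longrightarrow> u < x"
  shows "holding a b p (insert x A) \<longleftrightarrow> p x = a \<or> p x \<noteq> b \<and> holding a b p A"
proof -
  have "\<not> x < v" "v \<noteq> x" if "v \<in> A" for v
    using assms(2)[OF that] by auto
  then show ?thesis using assms unfolding holding_def by auto
qed

text \<open>Each sale locks in \<^term>\<open>b - a\<close>, and at most one unit bought at \<^term>\<open>a\<close> is open.\<close>

lemma trade_profit:
  assumes "finite A" and ab: "a \<noteq> b"
  shows "(\<Sum>u\<in>A. of_int (trade_sign a b p (A \<inter> {..<u}) u) * (p u - y)) =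
    real (card (sale_times a b p A)) * (b - a) + of_bool (holding a b p A) * (y - a)"
  using assms(1)
\<comment> \<open>Adding the latest time leaves all earlier trades unchanged, since each depends
  only on times before it.\<close>
proof (induction A rule: finite_linorder_max_induct)
  case empty
  then show ?case by (simp add: holding_def sale_times_def)
next
  case (insert x A)
  have below: "insert x A \<inter> {..<u} = A \<inter> {..<u}" if "u \<in> A" for u
    using insert.hyps that by force
  have at: "insert x A \<inter> {..<x} = A" using insert.hyps by force
  have notin: "x \<notin> A" using insert.hyps by blast
  have "sale_times a b p (insert x A) =
      (if p x = b \<and> holding a b p A then insert x (sale_times a b p A) else sale_times a b p A)"
  proof (rule set_eqI)
    fix u
    show "u \<in> sale_times a b p (insert x A) \<longleftrightarrow> u \<in>
        (if p x = b \<and> holding a b p A then insert x (sale_times a b p A) else sale_times a b p A)"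
    proof (cases "u = x")
      case True
      then show ?thesis unfolding sale_times_def mem_Collect_eq at True using notin by simp
    next
      case False
      have "u \<in> sale_times a b p (insert x A) \<longleftrightarrow> u \<in> sale_times a b p A"
      proof (cases "u \<in> A")
        case True
        then show ?thesis unfolding sale_times_def mem_Collect_eq below[OF True] by simp
      next
        case nonmem: False
        then show ?thesis unfolding sale_times_def using False by blast
      qed
      then show ?thesis using False by simp
    qed
  qed
  moreover have "finite (sale_times a b p A)" "x \<notin> sale_times a b p A"
    using insert.hyps notin by (auto simp: sale_times_def)
  ultimately have "real (card (sale_times a b p (insert x A))) =
      real (card (sale_times a b p A)) + of_bool (p x = b \<and> holding a b p A)"
    by simp
  moreover have "(\<Sum>u\<in>insert x A. of_int (trade_sign a b p (insert x A \<inter> {..<u}) u) * (p u - y)) =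
      of_int (trade_sign a b p A x) * (p x - y) +
      (\<Sum>u\<in>A. of_int (trade_sign a b p (A \<inter> {..<u}) u) * (p u - y))"
  proof -
    have "(\<Sum>u\<in>A. of_int (trade_sign a b p (insert x A \<inter> {..<u}) u) * (p u - y)) =
        (\<Sum>u\<in>A. of_int (trade_sign a b p (A \<inter> {..<u}) u) * (p u - y))"
      by (rule sum.cong) (simp_all only: below)
    then show ?thesis unfolding sum.insert[OF insert.hyps(1) notin] at by simp
  qed
  \<comment> \<open>A purchase contributes \<open>y - a\<close> and opens the unit. A sale
    contributes \<open>b - y\<close>, which is the locked-in \<open>b - a\<close> minus the value
    \<open>y - a\<close> of the unit that it closes.\<close>
  moreover have "of_int (trade_sign a b p A x) * (p x - y) =
      of_bool (p x = b \<and> holding a b p A) * (b - a) +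
      (of_bool (holding a b p (insert x A)) - of_bool (holding a b p A)) * (y - a)"
    using ab holding_insert[OF ab, of A x p] insert.hyps by (auto simp: trade_sign_def)
  ultimately show ?case
    by (simp only: insert.IH) (simp only: distrib_right left_diff_distrib)
qed

lemma trading_times_finite: "trading_times T \<Longrightarrow> finite (T \<inter> {x..y})"
  by (simp add: trading_times_def)

text \<open>After any visit to \<open>a\<close>, whether or not it is itself a purchase, the
  position stays open until the next visit to \<open>b\<close>, which is therefore a sale. Taking
  the visit after \<open>max x 0\<close> puts it among the observed times and the sale beyond
  \<open>x\<close>.\<close>

lemma sale_times_unbounded:
  assumes T: "trading_times T" and ab: "a \<noteq> b"
    and a: "\<And>x. \<exists>u\<in>T. x < u \<and> p u = a" and b: "\<And>x. \<exists>u\<in>T. x < u \<and> p u = b"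
  shows "\<exists>v\<in>sale_times a b p (T \<inter> {0..}). x < v"
proof -
  obtain u where u: "u \<in> T" "max x 0 < u" "p u = a" using a by blast
  obtain v where v: "v \<in> T" "u < v" "p v = b" using b by blast
  define Q where "Q v \<longleftrightarrow> u < v \<and> p v = b" for v
  have "v \<in> T \<inter> {u..v}" "Q v" using v by (auto simp: Q_def)
  then obtain w where wA: "w \<in> T \<inter> {u..v}" and wQ: "Q w"
    and min: "\<And>x. x \<in> T \<inter> {u..v} \<Longrightarrow> Q x \<Longrightarrow> w \<le> x"
    using finite_earliest[OF trading_times_finite[OF T]] by metis
  have w: "w \<in> T" "w \<le> v" "u < w" "p w = b" using wA wQ by (auto simp: Q_def)
  have first: "p x \<noteq> b" if "x \<in> T" "u < x" "x < w" for x
    using min[of x] that w by (auto simp: Q_def)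
  have "holding a b p (T \<inter> {0..} \<inter> {..<w})"
    unfolding holding_def by (rule bexI[of _ u]) (use u w first in auto)
  then have "w \<in> sale_times a b p (T \<inter> {0..})"
    using w u by (auto simp: sale_times_def)
  moreover have "x < w" using w u by simp
  ultimately show ?thesis by blast
qed

text \<open>Whether a visit is a sale depends on earlier times only, so cutting the record at
  \<open>t\<close> neither creates nor destroys sales up to \<open>t\<close>.\<close>

lemma sale_times_initial:
  "sale_times a b p (T \<inter> {0..t}) = sale_times a b p (T \<inter> {0..}) \<inter> {..t}"
proof -
  have "T \<inter> {0..t} \<inter> {..<u} = T \<inter> {0..} \<inter> {..<u}" if "u \<le> t" for u
    using that by auto
  then show ?thesis by (auto simp: sale_times_def)
qed

lemma sale_count_eventually:
  assumes T: "trading_times T" and unb: "\<And>x. \<exists>v\<in>sale_times a b p (T \<inter> {0..}). x < v"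
  shows "\<exists>t0. \<forall>t\<ge>t0. n \<le> card (sale_times a b p (T \<inter> {0..t}))"
proof -
  let ?Z = "sale_times a b p (T \<inter> {0..})"
  have "infinite ?Z"
  proof
    assume fin: "finite ?Z"
    obtain v where "v \<in> ?Z" "Max ?Z < v" using unb by blast
    then show False using Max_ge[OF fin] by fastforce
  qed
  then obtain D where D: "D \<subseteq> ?Z" "finite D" "card D = n"
    using infinite_arbitrarily_large by blast
  show ?thesis
  \<comment> \<open>Inserting \<open>0\<close> keeps \<open>Max\<close> meaningful when
    \<open>n = 0\<close> and \<open>D\<close> is empty.\<close>
  proof (intro exI[of _ "Max (insert 0 D)"] allI impI)
    fix t assume t: "Max (insert 0 D) \<le> t"
    then have "D \<subseteq> sale_times a b p (T \<inter> {0..t})"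
      using D by (auto simp: sale_times_initial)
    moreover have "finite (sale_times a b p (T \<inter> {0..t}))"
      by (rule finite_subset[OF _ trading_times_finite[OF T, of 0 t]]) (auto simp: sale_times_def)
    ultimately show "n \<le> card (sale_times a b p (T \<inter> {0..t}))"
      using D card_mono by blast
  qed
qed

lemma trade_profit_filterlim:
  assumes T: "trading_times T" and ab: "a < b" and m: "m > 0" and nonneg: "\<And>t. t \<in> T \<Longrightarrow> 0 \<le> p t"
    and a0: "0 \<le> a"
    and a: "\<And>x. \<exists>u\<in>T. x < u \<and> p u = a" and b: "\<And>x. \<exists>u\<in>T. x < u \<and> p u = b"
  shows "filterlim (\<lambda>t. m * (\<Sum>u\<in>T \<inter> {0..t}.
      of_int (trade_sign a b p (T \<inter> {0..t} \<inter> {..<u}) u) * (p u - p t)))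
    at_top (inf at_top (principal T))"
proof -
  have ab': "a \<noteq> b" using ab by simp
  have "\<exists>t0. \<forall>t\<ge>t0. t \<in> T \<longrightarrow> c \<le> m * (\<Sum>u\<in>T \<inter> {0..t}.
      of_int (trade_sign a b p (T \<inter> {0..t} \<inter> {..<u}) u) * (p u - p t))" for c
  proof -
    \<comment> \<open>Enough cycles that their profit exceeds \<open>c / m\<close> even after the
      largest possible loss \<open>a\<close> on the open unit.\<close>
    obtain n :: nat where n: "(c / m + a) / (b - a) \<le> n" using real_arch_simple by blast
    then have n': "c / m \<le> real n * (b - a) - a" using ab by (simp add: field_simps)
    obtain t0 where t0: "\<And>t. t \<ge> t0 \<Longrightarrow> n \<le> card (sale_times a b p (T \<inter> {0..t}))"
      using sale_count_eventually[OF T sale_times_unbounded[OF T ab' a b]] by blast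
    have "c \<le> m * (\<Sum>u\<in>T \<inter> {0..t}.
        of_int (trade_sign a b p (T \<inter> {0..t} \<inter> {..<u}) u) * (p u - p t))"
      if t: "t \<ge> t0" "t \<in> T" for t
    proof -
      have "real n * (b - a) \<le> real (card (sale_times a b p (T \<inter> {0..t}))) * (b - a)"
        using t0[OF t(1)] ab by (intro mult_right_mono) auto
      \<comment> \<open>With a unit open this uses that the current price is nonnegative; with none
        open it uses \<open>0 \<le> a\<close>.\<close>
      moreover have "- a \<le> of_bool (holding a b p (T \<inter> {0..t})) * (p t - a)"
        using nonneg[OF t(2)] a0 by auto
      ultimately have "c / m \<le> (\<Sum>u\<in>T \<inter> {0..t}.
          of_int (trade_sign a b p (T \<inter> {0..t} \<inter> {..<u}) u) * (p u - p t))"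
        using n' unfolding trade_profit[OF trading_times_finite[OF T] ab'] by linarith
      then show ?thesis using m by (simp add: field_simps)
    qed
    then show ?thesis by blast
  qed
  then show ?thesis
    by (simp add: filterlim_at_top eventually_inf_principal eventually_at_top_linorder)
qed

subsection \<open>Profit and loss of combined orders\<close>

text \<open>Finiteness matters because \<open>sorted_list_of_set\<close> maps an infinite set to the
  empty list.\<close>

lemma set_filled_orders:
  assumes "finite {u \<in> A. X u \<omega> \<noteq> []}"
  shows "set (filled_orders P X A \<omega>) =
    {(u, s, p, q). u \<in> A \<and> p = P u \<omega> \<and> (s, q) \<in> set (X u \<omega>)}"
  using assms by (force simp: filled_orders_def)

lemma sorted_filled_orders: "sorted (map fst (filled_orders P X A \<omega>))"
proof -
  have "sorted (map fst (concat (map (\<lambda>t. map (\<lambda>(s, q). (t, s, P t \<omega>, q)) (X t \<omega>)) ts)))"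
    if "sorted ts" for ts
    using that by (induction ts) (auto simp: sorted_append o_def split_beta map_replicate_const)
  then show ?thesis unfolding filled_orders_def by simp
qed

text \<open>Times without orders contribute nothing, so the index set may be any finite set covering
  the fill times. This freedom lets two strategies be summed over the same times.\<close>

lemma PnL_eq_sum:
  assumes "finite D" "{u \<in> T. u \<le> t \<and> X u \<omega> \<noteq> []} \<subseteq> D" "D \<subseteq> T \<inter> {..t}"
  shows "PnL m T P X t \<omega> =
    m * (\<Sum>u\<in>D. \<Sum>(s, q)\<leftarrow>X u \<omega>. of_int s * (P u \<omega> - P t \<omega>) * q)"
proof -
  let ?f = "\<lambda>u. \<Sum>(s, q)\<leftarrow>X u \<omega>. of_int s * (P u \<omega> - P t \<omega>) * q"
  let ?D = "{u \<in> {u \<in> T. u \<le> t}. X u \<omega> \<noteq> []}"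
  have "(\<Sum>(u, s, p, q)\<leftarrow>concat (map (\<lambda>t. map (\<lambda>(s, q). (t, s, P t \<omega>, q)) (X t \<omega>)) ts).
      of_int s * (p - P t \<omega>) * q) = (\<Sum>u\<leftarrow>ts. ?f u)" for ts
    by (induction ts) (simp_all add: o_def split_beta)
  then have "PnL m T P X t \<omega> = m * (\<Sum>u\<leftarrow>sorted_list_of_set ?D. ?f u)"
    by (simp add: PnL_def filled_orders_def)
  also have "(\<Sum>u\<leftarrow>sorted_list_of_set ?D. ?f u) = (\<Sum>u\<in>?D. ?f u)"
    using finite_subset[OF assms(2,1)] by (subst sum_list_distinct_conv_sum_set) auto
  also have "\<dots> = (\<Sum>u\<in>D. ?f u)"
    by (rule sum.mono_neutral_left) (use assms in auto)
  finally show ?thesis .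
qed

lemma PnL_add_order:
  assumes X: "finite {u \<in> T. u \<le> t \<and> X u \<omega> \<noteq> []}"
    and D: "finite D" "D \<subseteq> T \<inter> {..t}"
    and d: "\<And>u. d u \<in> {-1, 0, 1}" "\<And>u. u \<in> T \<Longrightarrow> u \<le> t \<Longrightarrow> u \<notin> D \<Longrightarrow> d u = 0"
    and Y: "\<And>u. Y u \<omega> = add_order (d u) (X u \<omega>)"
  shows "PnL m T P Y t \<omega> = PnL m T P X t \<omega> + m * (\<Sum>u\<in>D. of_int (d u) * (P u \<omega> - P t \<omega>))"
proof -
  \<comment> \<open>Covers the fill times of both \<open>X\<close> and \<open>Y\<close>.\<close>
  let ?C = "D \<union> {u \<in> T. u \<le> t \<and> X u \<omega> \<noteq> []}"
  have C: "finite ?C" "?C \<subseteq> T \<inter> {..t}" using X D by auto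
  have "{u \<in> T. u \<le> t \<and> Y u \<omega> \<noteq> []} \<subseteq> ?C"
    using d(2) by (force simp: Y add_order_def)
  then have "PnL m T P Y t \<omega> =
      m * (\<Sum>u\<in>?C. \<Sum>(s, q)\<leftarrow>Y u \<omega>. of_int s * (P u \<omega> - P t \<omega>) * q)"
    by (rule PnL_eq_sum[OF C(1) _ C(2)])
  also have "(\<Sum>u\<in>?C. \<Sum>(s, q)\<leftarrow>Y u \<omega>. of_int s * (P u \<omega> - P t \<omega>) * q) =
      (\<Sum>u\<in>?C. of_int (d u) * (P u \<omega> - P t \<omega>) +
        (\<Sum>(s, q)\<leftarrow>X u \<omega>. of_int s * (P u \<omega> - P t \<omega>) * q))"
  proof (rule sum.cong)
    fix u
    show "(\<Sum>(s, q)\<leftarrow>Y u \<omega>. of_int s * (P u \<omega> - P t \<omega>) * q) =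
        of_int (d u) * (P u \<omega> - P t \<omega>) +
        (\<Sum>(s, q)\<leftarrow>X u \<omega>. of_int s * (P u \<omega> - P t \<omega>) * q)"
      using d(1)[of u] by (auto simp: Y add_order_def)
  qed simp
  also have "\<dots> = (\<Sum>u\<in>?C. of_int (d u) * (P u \<omega> - P t \<omega>)) +
      (\<Sum>u\<in>?C. \<Sum>(s, q)\<leftarrow>X u \<omega>. of_int s * (P u \<omega> - P t \<omega>) * q)"
    by (rule sum.distrib)
  also have "(\<Sum>u\<in>?C. of_int (d u) * (P u \<omega> - P t \<omega>)) = (\<Sum>u\<in>D. of_int (d u) * (P u \<omega> - P t \<omega>))"
    by (rule sum.mono_neutral_right) (use C d(2) in auto)
  finally show ?thesis
    using PnL_eq_sum[OF C(1) _ C(2), of X \<omega> m P] by (simp add: algebra_simps)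
qed

subsection \<open>Measurability\<close>

lemma listset_subset_lists: "As \<in> lists (sets N) \<Longrightarrow> listset As \<subseteq> lists (space N)"
proof (induction As)
  case (Cons A As)
  then have "A \<subseteq> space N" "listset As \<subseteq> lists (space N)" by (auto dest: sets.sets_into_space)
  then have "x # xs \<in> lists (space N)" if "x \<in> A" "xs \<in> listset As" for x xs
    using that by (intro lists.Cons) (rule subsetD, assumption+)+
  then show ?case by (auto simp only: listset.simps set_Cons_def)
qed simp

lemma space_list_space [simp]: "space (list_space N) = lists (space N)"
  unfolding list_space_def using listset_subset_lists by (intro space_measure_of) blast

lemma sets_list_space: "sets (list_space N) = sigma_sets (lists (space N)) (listset ` lists (sets N))"
  unfolding list_space_def using listset_subset_lists by (intro sets_measure_of) blast

lemma listset_in_sets: "As \<in> lists (sets N) \<Longrightarrow> listset As \<in> sets (list_space N)"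
  unfolding sets_list_space by (rule sigma_sets.Basic) simp

lemma listset_replicate: "listset (replicate n A) = {xs \<in> lists A. length xs = n}"
proof (induction n)
  case (Suc n)
  then show ?case by (auto simp: set_Cons_def length_Suc_conv)
qed auto

text \<open>Split by length, the lists over \<open>A\<close> form a countable union of generating
  rectangles.\<close>

lemma lists_in_sets:
  assumes "A \<in> sets N"
  shows "lists A \<in> sets (list_space N)"
proof -
  have "listset (replicate n A) \<in> sets (list_space N)" for n
    using assms by (intro listset_in_sets) (auto simp: in_lists_conv_set)
  then have "(\<Union>n. listset (replicate n A)) \<in> sets (list_space N)" by blast
  also have "(\<Union>n. listset (replicate n A)) = lists A" by (auto simp: listset_replicate)
  finally show ?thesis .
qed

lemma length_measurable: "{xs \<in> lists (space N). P (length xs)} \<in> sets (list_space N)"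
proof -
  have "listset (replicate n (space N)) \<in> sets (list_space N)" for n
    by (intro listset_in_sets) (auto simp: in_lists_conv_set)
  then have "(\<Union>n\<in>{n. P n}. listset (replicate n (space N))) \<in> sets (list_space N)" by blast
  also have "(\<Union>n\<in>{n. P n}. listset (replicate n (space N))) = {xs \<in> lists (space N). P (length xs)}"
    by (auto simp: listset_replicate)
  finally show ?thesis .
qed

text \<open>The preimage of a rectangle is the rectangle of its remaining sides if \<open>y\<close>
  lies in the first side, and empty otherwise.\<close>

lemma Cons_measurable:
  assumes "y \<in> space N"
  shows "(#) y \<in> list_space N \<rightarrow>\<^sub>M list_space N"
  unfolding list_space_def[of N]
proof (rule measurable_sigma_sets)
  show "sets (sigma (lists (space N)) (listset ` lists (sets N))) =
      sigma_sets (lists (space N)) (listset ` lists (sets N))"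
    using sets_list_space by (simp add: list_space_def)
  show "listset ` lists (sets N) \<subseteq> Pow (lists (space N))"
    using listset_subset_lists by blast
  have sp: "space (sigma (lists (space N)) (listset ` lists (sets N))) = lists (space N)"
    using space_list_space by (simp add: list_space_def)
  show "(#) y \<in> space (sigma (lists (space N)) (listset ` lists (sets N))) \<rightarrow> lists (space N)"
    using assms by (auto simp: sp)
  fix B assume "B \<in> listset ` lists (sets N)"
  then obtain As where As: "As \<in> lists (sets N)" "B = listset As" by blast
  have "(#) y -` B \<inter> lists (space N) \<in> sets (list_space N)"
  proof (cases As)
    case (Cons C Cs)
    then have "(#) y -` B \<inter> lists (space N) = (if y \<in> C then listset Cs else {})"
      using As listset_subset_lists[of Cs N] by (auto simp: set_Cons_def)
    then show ?thesis using As Cons listset_in_sets[of Cs N] by auto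
  next
    case Nil
    then have "(#) y -` B \<inter> lists (space N) = {}" using As by auto
    then show ?thesis by simp
  qed
  then show "(#) y -` B \<inter> space (sigma (lists (space N)) (listset ` lists (sets N)))
      \<in> sets (sigma (lists (space N)) (listset ` lists (sets N)))"
    by (simp add: list_space_def[symmetric])
qed

lemma space_order_space: "space order_space = {1, -1} \<times> {0<..}"
  by (simp add: order_space_def space_pair_measure space_restrict_space)

lemma add_order_measurable: "add_order d \<in> list_space order_space \<rightarrow>\<^sub>M list_space order_space"
proof -
  have "add_order d = (if d = 1 then (#) (1, 1) else if d = -1 then (#) (-1, 1) else (\<lambda>xs. xs))"
    by (auto simp: add_order_def fun_eq_iff)
  then show ?thesis by (auto intro!: Cons_measurable simp: space_order_space)
qed

text \<open>The complement consists of the lists over the measurable set of fills at times other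
  than \<open>u\<close>. The added trade reads nothing else from the HTI.\<close>

lemma fill_time_measurable: "Measurable.pred (list_space filled_order_space) (\<lambda>h. u \<in> fst ` set h)"
proof -
  let ?C = "{x \<in> space filled_order_space. fst x \<noteq> u}"
  have "?C \<in> sets filled_order_space"
    unfolding filled_order_space_def by measurable
  then have "space (list_space filled_order_space) - lists ?C \<in> sets (list_space filled_order_space)"
    using lists_in_sets by blast
  also have "space (list_space filled_order_space) - lists ?C =
      {h \<in> space (list_space filled_order_space). u \<in> fst ` set h}"
    by (auto simp: in_lists_conv_set)
  finally show ?thesis by (simp add: pred_def)
qed

text \<open>The side \<open>d\<close> takes countably many values, so it suffices to treat each
  fixed side; the law of the enlarged orders is handled in the same way below.\<close>

lemma measurable_add_order:
  assumes [measurable]: "d \<in> N \<rightarrow>\<^sub>M count_space UNIV" and X: "X \<in> N \<rightarrow>\<^sub>M list_space order_space"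
  shows "(\<lambda>\<omega>. add_order (d \<omega>) (X \<omega>)) \<in> N \<rightarrow>\<^sub>M list_space order_space"
  by (rule measurable_compose_countable[OF measurable_compose[OF X add_order_measurable]]) fact

lemma measurable_distr_add_order:
  assumes [measurable]: "d \<in> N \<rightarrow>\<^sub>M count_space UNIV"
    and K: "K \<in> N \<rightarrow>\<^sub>M prob_algebra (list_space order_space)"
  shows "(\<lambda>\<omega>. distr (K \<omega>) (list_space order_space) (add_order (d \<omega>)))
    \<in> N \<rightarrow>\<^sub>M prob_algebra (list_space order_space)"
  by (rule measurable_compose_countable[OF measurable_compose[OF K
        measurable_distr_prob_space[OF add_order_measurable]]]) fact

text \<open>The predicate \<open>R\<close> selects the recorded times: all of them for the trade
  read off the market data, the fill times in the HTI argument for the one used by the rule.\<close>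

lemma measurable_trade_sign:
  assumes D: "finite D" and [measurable]: "\<And>u. u \<in> insert t D \<Longrightarrow> p u \<in> borel_measurable N"
    "\<And>u. u \<in> D \<Longrightarrow> Measurable.pred N (R u)"
  shows "(\<lambda>x. trade_sign a b (\<lambda>u. p u x) {u \<in> D. R u x} t) \<in> N \<rightarrow>\<^sub>M count_space UNIV"
proof -
  have "holding a b (\<lambda>u. p u x) {u \<in> D. R u x} \<longleftrightarrow>
     (\<exists>u\<in>D. R u x \<and> p u x = a \<and> (\<forall>v\<in>D. u < v \<longrightarrow> R v x \<longrightarrow> p v x \<noteq> b))" for x
    by (auto simp: holding_def)
  moreover note D[measurable]
  have "Measurable.pred N (\<lambda>x. \<exists>u\<in>D. R u x \<and> p u x = a \<and> (\<forall>v\<in>D. u < v \<longrightarrow> R v x \<longrightarrow> p v x \<noteq> b))"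
    using D by measurable
  ultimately have [measurable]: "Measurable.pred N (\<lambda>x. holding a b (\<lambda>u. p u x) {u \<in> D. R u x})"
    by simp
  show ?thesis unfolding trade_sign_def by measurable
qed

text \<open>Were the laws equal, almost sure length at least \<open>n\<close> would pass to length
  at least \<open>n + 1\<close>, so by induction a random finite list would be longer than every
  number. Thus an extra sale changes the law, whatever the original orders are.\<close>

lemma add_order_law_neq:
  assumes "K \<in> space (prob_algebra (list_space order_space))"
  shows "distr K (list_space order_space) (add_order 0) \<noteq> distr K (list_space order_space) (add_order 1)"
proof
  let ?L = "list_space order_space"
  assume eq: "distr K ?L (add_order 0) = distr K ?L (add_order 1)"
  have K: "prob_space K" "sets K = sets ?L" using assms by (auto simp: space_prob_algebra)
  then interpret prob_space K by simp
  have sp: "space K = lists (space order_space)" using sets_eq_imp_space_eq[OF K(2)] by simp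
  have m: "add_order d \<in> K \<rightarrow>\<^sub>M ?L" for d
    using add_order_measurable measurable_cong_sets[OF K(2) refl] by blast
  have set: "{xs \<in> space ?L. n \<le> length xs} \<in> sets ?L" for n
    using length_measurable[of order_space "\<lambda>k. n \<le> k"] by simp
  have "AE xs in K. n \<le> length xs" for n
  proof (induction n)
    case (Suc n)
    then have "AE xs in distr K ?L (add_order 1). Suc n \<le> length xs"
      by (simp add: AE_distr_iff[OF m set] add_order_def)
    then have "AE xs in distr K ?L (add_order 0). Suc n \<le> length xs" by (simp only: eq)
    then show ?case by (simp add: AE_distr_iff[OF m set] add_order_def)
  qed simp
  then have "AE xs in K. \<forall>n. n \<le> length xs" by (simp add: AE_all_countable)
  then have "AE xs in K. False" by eventually_elim (metis not_less_eq_eq order_refl)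
  then show False by simp
qed

subsection \<open>Recurrence of the extreme prices\<close>

lemma trading_times_countable:
  assumes "trading_times T"
  shows "countable T"
proof -
  have "T = (\<Union>n::nat. T \<inter> {- real n..real n})"
  proof (intro equalityI subsetI)
    fix t assume "t \<in> T"
    obtain n :: nat where "\<bar>t\<bar> \<le> n" using real_arch_simple by blast
    then show "t \<in> (\<Union>n::nat. T \<inter> {- real n..real n})" using \<open>t \<in> T\<close> by (intro UN_I[of n]) auto
  qed auto
  moreover have "countable (\<Union>n::nat. T \<inter> {- real n..real n})"
    using trading_times_finite[OF assms] by (intro countable_UN) (auto intro: countable_finite)
  ultimately show ?thesis by simp
qed

text \<open>Every visit to \<open>a\<close> or \<open>b\<close> is followed by a visit to the other
  price, so there is no last one; since bounded intervals hold finitely many times, the visits pass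
  every bound. One visit beyond \<open>x\<close> and its successor supply both prices.\<close>

lemma alternating_visits_unbounded:
  assumes T: "trading_times T" and start: "t \<in> T" "p t = a \<or> p t = b"
    and ab: "\<And>u. u \<in> T \<Longrightarrow> p u = a \<Longrightarrow> \<exists>v\<in>T. u < v \<and> p v = b"
    and ba: "\<And>u. u \<in> T \<Longrightarrow> p u = b \<Longrightarrow> \<exists>v\<in>T. u < v \<and> p v = a"
  shows "(\<exists>u\<in>T. x < u \<and> p u = a) \<and> (\<exists>u\<in>T. x < u \<and> p u = b)"
proof -
  let ?V = "{u \<in> T. p u = a \<or> p u = b}"
  have beyond: "\<exists>u\<in>?V. x < u"
  proof (rule ccontr)
    assume "\<not> (\<exists>u\<in>?V. x < u)"
    then have le: "\<forall>u\<in>?V. u \<le> x" by (auto simp: not_less)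
    let ?A = "?V \<inter> {t..x}"
    have fin: "finite ?A"
      by (rule finite_subset[OF _ trading_times_finite[OF T, of t x]]) auto
    moreover have "t \<in> ?A" using start le by auto
    ultimately have max: "Max ?A \<in> ?A" by (intro Max_in) auto
    then obtain v where v: "v \<in> ?V" "Max ?A < v" using ab ba by blast
    then have "v \<in> ?A" using le max by auto
    then show False using Max_ge[OF fin] v by fastforce
  qed
  then obtain u where u: "u \<in> ?V" "x < u" by blast
  then obtain v where v: "v \<in> T" "u < v" "p u = a \<and> p v = b \<or> p u = b \<and> p v = a"
    using ab ba by blast
  have "x < v" using u v by simp
  then show ?thesis using u v by blast
qed

lemma AE_passage:
  assumes M: "prob_space M" and P: "P t \<in> borel_measurable M"
    and rec: "\<P>(\<omega> in M. P t \<omega> = p) > 0 \<Longrightarrow> recurrent_passage M T P E t p Q"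
  shows "AE \<omega> in M. P t \<omega> = p \<longrightarrow> (\<exists>v\<in>T. t < v \<and> Q (P v \<omega>) \<and> P v \<omega> \<in> E)"
proof -
  interpret prob_space M by fact
  let ?B = "{\<omega> \<in> space M. P t \<omega> = p}"
  let ?C = "{\<omega> \<in> space M. (\<exists>u. u \<in> passages T P E t Q \<omega>) \<and> P t \<omega> = p}"
  have B: "?B \<in> sets M" using P by measurable
  show ?thesis
  proof (cases "prob ?B = 0")
    case True
    then have "AE \<omega> in M. \<omega> \<notin> ?B" using B prob_eq_0 by simp
    with AE_space show ?thesis by eventually_elim auto
  next
    case False
    then have pos: "prob ?B > 0" using zero_less_measure_iff by blast
    then have "prob ?C / prob ?B = 1"
      using rec unfolding recurrent_passage_def cond_prob_def by blast
    then have eq: "prob ?C = prob ?B" using pos by simp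
    \<comment> \<open>A set outside the algebra has \<open>measure\<close> 0, so the positive value
      forces measurability of the passage event.\<close>
    then have C: "?C \<in> sets M" using pos measure_notin_sets by force
    have "prob (?B - ?C) = 0"
      using finite_measure_Diff[OF B C] eq by auto
    then have "AE \<omega> in M. \<omega> \<notin> ?B - ?C" using B C prob_eq_0 by blast
    with AE_space show ?thesis
    proof eventually_elim
      case (elim \<omega>)
      show ?case
      proof
        assume "P t \<omega> = p"
        then obtain u where "u \<in> passages T P E t Q \<omega>" using elim by blast
        then show "\<exists>v\<in>T. t < v \<and> Q (P v \<omega>) \<and> P v \<omega> \<in> E"
          by (intro bexI[of _ "t + u"]) (auto simp: passages_def)
      qed
    qed
  qed
qed

text \<open>With the threshold at the second highest price, a passage beyond it is a visit to the maximum
  of \<^term>\<open>E\<close>; likewise below.\<close>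

lemma up_threshold_Max:
  assumes E: "finite E" and up: "up_threshold E p \<xi>"
  shows "p < Max (E - {Max E})" and "up_threshold E p (Max (E - {Max E}) - p)"
    and "x \<in> E \<Longrightarrow> x > Max (E - {Max E}) \<Longrightarrow> x = Max E"
proof -
  let ?b = "Max E" and ?b' = "Max (E - {Max E})"
  obtain y where y: "y \<in> E" "p + \<xi> < y" and p: "p \<in> E" "p + \<xi> \<in> E" "\<xi> > 0"
    using up by (auto simp: up_threshold_def)
  have "y \<le> ?b" using y E by simp
  \<comment> \<open>\<open>p + \<xi>\<close> is above \<open>p\<close> and has a price of
    \<open>E\<close> above it, so it is not the maximum; hence the second highest price exists and
    lies strictly above \<open>p\<close>.\<close>
  then have mem: "p + \<xi> \<in> E - {?b}" using p y by auto
  then have "p + \<xi> \<le> ?b'" using E by (intro Max_ge) auto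
  then show less: "p < ?b'" using p by simp
  have b': "?b' \<in> E - {?b}" using E mem by (intro Max_in) auto
  have b: "?b \<in> E" using E p by (intro Max_in) auto
  have "?b' \<le> ?b" using b' E by (intro Max_ge) auto
  then have "?b' < ?b" using b' by auto
  then show "up_threshold E p (?b' - p)"
    using less b b' p by (auto simp: up_threshold_def)
  show "x = ?b" if "x \<in> E" "x > ?b'"
  proof (rule ccontr)
    assume "x \<noteq> ?b"
    then have "x \<le> ?b'" using E that by (intro Max_ge) auto
    then show False using that by simp
  qed
qed

lemma down_threshold_Min:
  assumes E: "finite E" and down: "down_threshold E p \<zeta>"
  shows "Min (E - {Min E}) < p" and "down_threshold E p (p - Min (E - {Min E}))"
    and "x \<in> E \<Longrightarrow> x < Min (E - {Min E}) \<Longrightarrow> x = Min E"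
proof -
  let ?b = "Min E" and ?b' = "Min (E - {Min E})"
  obtain y where y: "y \<in> E" "y < p - \<zeta>" and p: "p \<in> E" "p - \<zeta> \<in> E" "\<zeta> > 0"
    using down by (auto simp: down_threshold_def)
  have "?b \<le> y" using y E by simp
  then have mem: "p - \<zeta> \<in> E - {?b}" using p y by auto
  then have "?b' \<le> p - \<zeta>" using E by (intro Min_le) auto
  then show less: "?b' < p" using p by simp
  have b': "?b' \<in> E - {?b}" using E mem by (intro Min_in) auto
  have b: "?b \<in> E" using E p by (intro Min_in) auto
  have "?b \<le> ?b'" using b' E by (intro Min_le) auto
  then have "?b < ?b'" using b' by auto
  then show "down_threshold E p (p - ?b')"
    using less b b' p by (auto simp: down_threshold_def)
  show "x = ?b" if "x \<in> E" "x < ?b'"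
  proof (rule ccontr)
    assume "x \<noteq> ?b"
    then have "?b' \<le> x" using E that by (intro Min_le) auto
    then show False using that by simp
  qed
qed

text \<open>No price of \<open>E\<close> lies below the minimum, so the threshold that suitability
  of \<open>E\<close> grants there must be an upper one. This guarantees the way back from the
  minimum to the maximum.\<close>

lemma Min_has_up_threshold:
  assumes "finite E" "E \<noteq> {}" "(\<exists>\<xi>. up_threshold E (Min E) \<xi>) \<or> (\<exists>\<zeta>. down_threshold E (Min E) \<zeta>)"
  shows "\<exists>\<xi>. up_threshold E (Min E) \<xi>"
proof -
  have "\<not> down_threshold E (Min E) \<zeta>" for \<zeta>
  proof
    assume "down_threshold E (Min E) \<zeta>"
    then have "Min E - \<zeta> \<in> E" "\<zeta> > 0" by (auto simp: down_threshold_def)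
    then show False using Min_le[OF assms(1)] by fastforce
  qed
  then show ?thesis using assms by blast
qed

lemma Max_has_down_threshold:
  assumes "finite E" "E \<noteq> {}" "(\<exists>\<xi>. up_threshold E (Max E) \<xi>) \<or> (\<exists>\<zeta>. down_threshold E (Max E) \<zeta>)"
  shows "\<exists>\<zeta>. down_threshold E (Max E) \<zeta>"
proof -
  have "\<not> up_threshold E (Max E) \<xi>" for \<xi>
  proof
    assume "up_threshold E (Max E) \<xi>"
    then have "Max E + \<xi> \<in> E" "\<xi> > 0" by (auto simp: up_threshold_def)
    then show False using Max_ge[OF assms(1)] by fastforce
  qed
  then show ?thesis using assms by blast
qed

text \<open>Any visited price of \<open>E\<close> has a threshold on some side and so leads to one
  of the extremes; from then on the extremes alternate. Countability of \<open>T\<close> and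
  \<open>E\<close> allows one null set for all times and prices. The premise excludes paths that
  never enter \<open>E\<close>.\<close>

lemma AE_extreme_prices_recur:
  assumes M: "prob_space M" and T: "trading_times T" and E: "finite E" "E \<noteq> {}"
    and proc: "price_process M T P \<Gamma> E"
  shows "AE \<omega> in M. (\<exists>t\<in>T. P t \<omega> \<in> E) \<longrightarrow>
    (\<forall>x. (\<exists>u\<in>T. x < u \<and> P u \<omega> = Min E) \<and> (\<exists>u\<in>T. x < u \<and> P u \<omega> = Max E))"
proof -
  have P: "P t \<in> borel_measurable M" if "t \<in> T" for t
    using proc that by (auto simp: price_process_def)
  have thr: "(\<exists>\<xi>. up_threshold E p \<xi>) \<or> (\<exists>\<zeta>. down_threshold E p \<zeta>)" if "p \<in> E" for p
    using proc that by (auto simp: price_process_def)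
  have up: "AE \<omega> in M. P t \<omega> = p \<longrightarrow> (\<exists>v\<in>T. t < v \<and> P v \<omega> = Max E)"
    if "t \<in> T" and th: "up_threshold E p \<xi>" for t p \<xi>
  proof -
    note Max = up_threshold_Max[OF E(1) th]
    have "p \<in> E" using th by (simp add: up_threshold_def)
    then have rec: "recurrent_passage M T P E t p (\<lambda>x. x > p + (Max (E - {Max E}) - p))"
      if "\<P>(\<omega> in M. P t \<omega> = p) > 0"
      using proc Max(2) \<open>t \<in> T\<close> that unfolding price_process_def by blast
    have "AE \<omega> in M. P t \<omega> = p \<longrightarrow>
        (\<exists>v\<in>T. t < v \<and> P v \<omega> > p + (Max (E - {Max E}) - p) \<and> P v \<omega> \<in> E)"
      by (rule AE_passage[where P = P and t = t, OF M P[OF \<open>t \<in> T\<close>] rec])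
    then show ?thesis by eventually_elim (use Max(3) in fastforce)
  qed
  have down: "AE \<omega> in M. P t \<omega> = p \<longrightarrow> (\<exists>v\<in>T. t < v \<and> P v \<omega> = Min E)"
    if "t \<in> T" and th: "down_threshold E p \<zeta>" for t p \<zeta>
  proof -
    note Min = down_threshold_Min[OF E(1) th]
    have "p \<in> E" using th by (simp add: down_threshold_def)
    then have rec: "recurrent_passage M T P E t p (\<lambda>x. x < p - (p - Min (E - {Min E})))"
      if "\<P>(\<omega> in M. P t \<omega> = p) > 0"
      using proc Min(2) \<open>t \<in> T\<close> that unfolding price_process_def by blast
    have "AE \<omega> in M. P t \<omega> = p \<longrightarrow>
        (\<exists>v\<in>T. t < v \<and> P v \<omega> < p - (p - Min (E - {Min E})) \<and> P v \<omega> \<in> E)"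
      by (rule AE_passage[where P = P and t = t, OF M P[OF \<open>t \<in> T\<close>] rec])
    then show ?thesis by eventually_elim (use Min(3) in fastforce)
  qed
  have cT: "countable T" by (rule trading_times_countable[OF T])
  have cE: "countable E" using E by (simp add: countable_finite)
  have "AE \<omega> in M. \<forall>t\<in>T. \<forall>p\<in>E.
      P t \<omega> = p \<longrightarrow> (\<exists>v\<in>T. t < v \<and> (P v \<omega> = Min E \<or> P v \<omega> = Max E))"
    unfolding AE_ball_countable[OF cT] AE_ball_countable[OF cE]
  proof (intro ballI)
    fix t p assume t: "t \<in> T" and "p \<in> E"
    then consider \<xi> where "up_threshold E p \<xi>" | \<zeta> where "down_threshold E p \<zeta>" using thr by blast
    then show "AE \<omega> in M. P t \<omega> = p \<longrightarrow> (\<exists>v\<in>T. t < v \<and> (P v \<omega> = Min E \<or> P v \<omega> = Max E))"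
    proof cases
      case 1
      from up[OF t 1] show ?thesis by eventually_elim blast
    next
      case 2
      from down[OF t 2] show ?thesis by eventually_elim blast
    qed
  qed
  moreover have "AE \<omega> in M. \<forall>t\<in>T. P t \<omega> = Min E \<longrightarrow> (\<exists>v\<in>T. t < v \<and> P v \<omega> = Max E)"
    unfolding AE_ball_countable[OF cT]
    using up Min_has_up_threshold[OF E thr[OF Min_in[OF E]]] by blast
  moreover have "AE \<omega> in M. \<forall>t\<in>T. P t \<omega> = Max E \<longrightarrow> (\<exists>v\<in>T. t < v \<and> P v \<omega> = Min E)"
    unfolding AE_ball_countable[OF cT]
    using down Max_has_down_threshold[OF E thr[OF Max_in[OF E]]] by blast
  ultimately show ?thesis
  proof eventually_elim
    case (elim \<omega>)
    show ?case
    proof (intro impI allI)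
      fix x assume "\<exists>t\<in>T. P t \<omega> \<in> E"
      then obtain v where "v \<in> T" "P v \<omega> = Min E \<or> P v \<omega> = Max E" using elim(1) by blast
      then show "(\<exists>u\<in>T. x < u \<and> P u \<omega> = Min E) \<and> (\<exists>u\<in>T. x < u \<and> P u \<omega> = Max E)"
        using elim(2,3) by (intro alternating_visits_unbounded[OF T]) auto
    qed
  qed
qed

subsection \<open>Executions\<close>

text \<open>In \<open>subalgebra A B\<close> the second algebra is the smaller one. The last clause
  is minimality: an algebra that knows the market data and the earlier executions contains the
  conditioning algebra.\<close>

lemma conditioning_algebra_subalgebra:
  assumes F: "market_data M T F P"
    and X: "\<And>t. t \<in> T \<Longrightarrow> X t \<in> M \<rightarrow>\<^sub>M list_space order_space"
  shows "subalgebra M (conditioning_algebra M T F X t)"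
    and "u \<in> T \<Longrightarrow> Y \<in> F u \<rightarrow>\<^sub>M N \<Longrightarrow> Y \<in> conditioning_algebra M T F X t \<rightarrow>\<^sub>M N"
    and "u \<in> T \<Longrightarrow> u < t \<Longrightarrow> X u \<in> conditioning_algebra M T F X t \<rightarrow>\<^sub>M list_space order_space"
    and "\<lbrakk>subalgebra M G; \<And>u. u \<in> T \<Longrightarrow> sets (F u) \<subseteq> sets G;
      \<And>u. u \<in> T \<Longrightarrow> u < t \<Longrightarrow> X u \<in> G \<rightarrow>\<^sub>M list_space order_space\<rbrakk>
      \<Longrightarrow> subalgebra G (conditioning_algebra M T F X t)"
proof -
  let ?G = "(\<Union>s\<in>T. sets (F s)) \<union>
    {X u -` B \<inter> space M | u B. u \<in> T \<and> u < t \<and> B \<in> sets (list_space order_space)}"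
  have FM: "sets (F s) \<subseteq> sets M" "space (F s) = space M" if "s \<in> T" for s
    using F that by (auto simp: market_data_def subalgebra_def)
  have GM: "?G \<subseteq> sets M"
    using FM X by (auto intro: measurable_sets)
  then have "?G \<subseteq> Pow (space M)" using sets.space_closed by blast
  then have sp: "space (conditioning_algebra M T F X t) = space M"
    and st: "sets (conditioning_algebra M T F X t) = sigma_sets (space M) ?G"
    unfolding conditioning_algebra_def by (rule space_measure_of, rule sets_measure_of)
  show "subalgebra M (conditioning_algebra M T F X t)"
    unfolding subalgebra_def sp st using GM sets.sigma_sets_subset by blast
  show "Y \<in> conditioning_algebra M T F X t \<rightarrow>\<^sub>M N" if u: "u \<in> T" and Y: "Y \<in> F u \<rightarrow>\<^sub>M N"
  proof (rule measurable_from_subalg[OF _ Y])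
    show "subalgebra (conditioning_algebra M T F X t) (F u)"
      unfolding subalgebra_def sp st using FM[OF u] u by (auto intro: sigma_sets.Basic)
  qed
  show "X u \<in> conditioning_algebra M T F X t \<rightarrow>\<^sub>M list_space order_space" if "u \<in> T" "u < t"
  proof (rule measurableI)
    show "X u \<omega> \<in> space (list_space order_space)"
      if "\<omega> \<in> space (conditioning_algebra M T F X t)" for \<omega>
      using that measurable_space[OF X[OF \<open>u \<in> T\<close>]] sp by simp
    show "X u -` B \<inter> space (conditioning_algebra M T F X t) \<in> sets (conditioning_algebra M T F X t)"
      if "B \<in> sets (list_space order_space)" for B
      unfolding sp st using that \<open>u \<in> T\<close> \<open>u < t\<close> by (intro sigma_sets.Basic) blast
  qed
  show "subalgebra G (conditioning_algebra M T F X t)"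
    if G: "subalgebra M G" and FG: "\<And>u. u \<in> T \<Longrightarrow> sets (F u) \<subseteq> sets G"
      and XG: "\<And>u. u \<in> T \<Longrightarrow> u < t \<Longrightarrow> X u \<in> G \<rightarrow>\<^sub>M list_space order_space"
  proof -
    have spG: "space G = space M" using G by (simp add: subalgebra_def)
    have "X u -` B \<inter> space M \<in> sets G" if "u \<in> T" "u < t" "B \<in> sets (list_space order_space)" for u B
      using measurable_sets[OF XG that(3)] that spG by simp
    then have "?G \<subseteq> sets G" using FG by blast
    then have "sigma_sets (space G) ?G \<subseteq> sets G" by (rule sets.sigma_sets_subset)
    then show ?thesis unfolding subalgebra_def sp st by (simp add: spG)
  qed
qed

text \<open>The event chosen by \<open>d\<close> splits over the finitely many values
  \<open>i\<close> into the products of the indicators of \<open>d \<omega> = i\<close> and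
  \<open>A i\<close>; the first factor is known to \<open>G\<close> and can be pulled out.\<close>

lemma real_cond_exp_indicator_selected:
  assumes M: "prob_space M" and G: "subalgebra M G" and I: "finite I"
    and d[measurable]: "d \<in> G \<rightarrow>\<^sub>M count_space UNIV" and dI: "\<And>\<omega>. d \<omega> \<in> I"
    and A[measurable]: "\<And>i. A i \<in> sets M"
    and ce: "\<And>i. i \<in> I \<Longrightarrow> AE \<omega> in M. real_cond_exp M G (indicator (A i)) \<omega> = g i \<omega>"
  shows "AE \<omega> in M. real_cond_exp M G (indicator {\<omega> \<in> space M. \<omega> \<in> A (d \<omega>)}) \<omega> = g (d \<omega>) \<omega>"
proof -
  interpret prob_space M by fact
  interpret finite_measure_subalgebra M G by unfold_locales fact
  have dM[measurable]: "d \<in> M \<rightarrow>\<^sub>M count_space UNIV" by (rule measurable_from_subalg[OF G d])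
  define f where "f i \<omega> = indicator {i} (d \<omega>) * (indicator (A i) \<omega> :: real)" for i \<omega>
  have f: "integrable M (f i)" for i
    unfolding f_def by (rule integrable_const_bound[of _ 1]) (auto simp: indicator_def)
  have split: "(\<Sum>i\<in>I. indicator {i} (d \<omega>) * h i) = h (d \<omega>)" for h :: "_ \<Rightarrow> real" and \<omega>
  proof -
    have "(\<Sum>i\<in>I. indicator {i} (d \<omega>) * h i) = (\<Sum>i\<in>I. if d \<omega> = i then h i else 0)"
      by (intro sum.cong) (auto simp: indicator_def)
    then show ?thesis using I dI[of \<omega>] by simp
  qed
  have set: "{\<omega> \<in> space M. \<omega> \<in> A (d \<omega>)} \<in> sets M"
  proof -
    have "{\<omega> \<in> space M. \<omega> \<in> A (d \<omega>)} = (\<Union>i\<in>I. A i \<inter> {\<omega> \<in> space M. d \<omega> = i})"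
      using dI sets.sets_into_space[OF A] by auto
    also have "\<dots> \<in> sets M" using I by (intro sets.finite_UN) auto
    finally show ?thesis .
  qed
  have "AE \<omega> in M. real_cond_exp M G (indicator {\<omega> \<in> space M. \<omega> \<in> A (d \<omega>)}) \<omega> =
      real_cond_exp M G (\<lambda>\<omega>. \<Sum>i\<in>I. f i \<omega>) \<omega>"
  proof (rule real_cond_exp_cong)
    show "AE \<omega> in M. indicator {\<omega> \<in> space M. \<omega> \<in> A (d \<omega>)} \<omega> = (\<Sum>i\<in>I. f i \<omega>)"
      using AE_space by eventually_elim (simp only: f_def split, simp add: indicator_def)
  qed (use set f in auto)
  moreover have "AE \<omega> in M. real_cond_exp M G (\<lambda>\<omega>. \<Sum>i\<in>I. f i \<omega>) \<omega> =
      (\<Sum>i\<in>I. real_cond_exp M G (f i) \<omega>)"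
    by (rule real_cond_exp_sum[OF f])
  moreover have "AE \<omega> in M. \<forall>i\<in>I. real_cond_exp M G (f i) \<omega> = indicator {i} (d \<omega>) * g i \<omega>"
  proof (rule AE_finite_allI[OF I])
    fix i assume i: "i \<in> I"
    have "AE \<omega> in M. real_cond_exp M G (f i) \<omega> =
        indicator {i} (d \<omega>) * real_cond_exp M G (indicator (A i)) \<omega>"
      unfolding f_def
    proof (rule real_cond_exp_mult)
      show "(\<lambda>\<omega>. indicat_real {i} (d \<omega>)) \<in> borel_measurable G"
        by (rule measurable_compose[OF d]) simp
      show "integrable M (\<lambda>\<omega>. indicat_real {i} (d \<omega>) * indicat_real (A i) \<omega>)"
        using f[of i] by (simp add: f_def[abs_def])
    qed simp
    then show "AE \<omega> in M. real_cond_exp M G (f i) \<omega> = indicator {i} (d \<omega>) * g i \<omega>"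
      using ce[OF i] by eventually_elim simp
  qed
  ultimately show ?thesis
    by eventually_elim (simp add: split cong: sum.cong)
qed

text \<open>Since the added order is determined by the market data, conditioning on the enlarged
  executions reveals no more than conditioning on the original ones.\<close>

lemma executes_add_order:
  assumes M: "prob_space M" and F: "market_data M T F P" and X: "executes M T F P K X"
    and K0: "\<And>t. t \<in> T \<Longrightarrow> K0 t \<in> F t \<rightarrow>\<^sub>M prob_algebra (list_space order_space)"
      "\<And>t. t \<in> T \<Longrightarrow> AE \<omega> in M. K t \<omega> (HTI T P X t \<omega>) = K0 t \<omega>"
    and d: "\<And>t. t \<in> T \<Longrightarrow> d t \<in> F t \<rightarrow>\<^sub>M count_space UNIV" "\<And>t \<omega>. d t \<omega> \<in> {-1, 0, 1}"
    and Y: "\<And>t \<omega>. Y t \<omega> = add_order (d t \<omega>) (X t \<omega>)"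
    and fin: "\<And>t \<omega>. t \<in> T \<Longrightarrow> \<omega> \<in> space M \<Longrightarrow> finite {u \<in> T. u \<le> t \<and> Y u \<omega> \<noteq> []}"
    and K': "\<And>t \<omega>. t \<in> T \<Longrightarrow> \<omega> \<in> space M \<Longrightarrow>
      K' t \<omega> (HTI T P Y t \<omega>) = distr (K0 t \<omega>) (list_space order_space) (add_order (d t \<omega>))"
  shows "executes M T F P K' Y"
proof -
  interpret prob_space M by fact
  let ?L = "list_space order_space"
  have XM: "X t \<in> M \<rightarrow>\<^sub>M ?L" if "t \<in> T" for t
    using X that by (auto simp: executes_def)
  have FM: "subalgebra M (F t)" if "t \<in> T" for t
    using F that by (auto simp: market_data_def)
  have Y': "Y t = (\<lambda>\<omega>. add_order (d t \<omega>) (X t \<omega>))" for t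
    using Y by blast
  have YM: "Y t \<in> M \<rightarrow>\<^sub>M ?L" if "t \<in> T" for t
    unfolding Y'
    by (intro measurable_add_order XM measurable_from_subalg[OF FM[OF that] d(1)[OF that]] that)
  have "AE \<omega> in M. real_cond_exp M (conditioning_algebra M T F Y t)
      (indicator (Y t -` B \<inter> space M)) \<omega> = measure (K' t \<omega> (HTI T P Y t \<omega>)) B"
    if t: "t \<in> T" and B: "B \<in> sets ?L" for t B
  proof -
    let ?G = "conditioning_algebra M T F X t" and ?H = "conditioning_algebra M T F Y t"
    note condX = conditioning_algebra_subalgebra[where t = t, OF F XM]
    note condY = conditioning_algebra_subalgebra[where t = t, OF F YM]
    have G: "subalgebra M ?G" and H: "subalgebra M ?H"
      using condX(1) condY(1) by auto
    \<comment> \<open>Each earlier \<open>Y u\<close> is a function of \<open>X u\<close> and of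
      \<open>d u\<close>, and the latter is market data.\<close>
    have GH: "subalgebra ?G ?H"
    proof (rule condY(4)[OF _ G])
      show "sets (F u) \<subseteq> sets ?G" if "u \<in> T" for u
      proof
        fix A assume A: "A \<in> sets (F u)"
        have "(\<lambda>\<omega>. \<omega>) \<in> ?G \<rightarrow>\<^sub>M F u" by (rule condX(2)[OF _ that]) auto
        then have "(\<lambda>\<omega>. \<omega>) -` A \<inter> space ?G \<in> sets ?G" using A by (rule measurable_sets)
        moreover have "A \<subseteq> space ?G"
          using sets.sets_into_space[OF A] FM[OF that] G by (auto simp: subalgebra_def)
        ultimately show "A \<in> sets ?G" by (simp add: Int_absorb2)
      qed
      show "Y u \<in> ?G \<rightarrow>\<^sub>M ?L" if "u \<in> T" "u < t" for u
        unfolding Y'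
        by (intro measurable_add_order condX(2)[OF _ \<open>u \<in> T\<close> d(1)[OF \<open>u \<in> T\<close>]]
            condX(3)[OF _ that]) auto
    qed auto
    interpret H: finite_measure_subalgebra M ?H by unfold_locales fact
    \<comment> \<open>\<open>A i\<close> contains the original order lists that land in
      \<open>B\<close> once the order of side \<open>i\<close> is added, so \<open>Y t\<close> lies
      in \<open>B\<close> exactly when \<open>X t\<close> lies in
      \<open>A (d t \<omega>)\<close>.\<close>
    define A where "A i = add_order i -` B \<inter> space ?L" for i
    have A: "A i \<in> sets ?L" for i
      unfolding A_def by (rule measurable_sets[OF add_order_measurable B])
    define g where "g \<omega> = measure (K0 t \<omega>) (A (d t \<omega>))" for \<omega>
    have dt: "d t \<in> F t \<rightarrow>\<^sub>M count_space UNIV" by (rule d(1)[OF t])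
    have gF: "g \<in> borel_measurable (F t)"
      unfolding g_def
      by (rule measurable_compose_countable[OF measurable_compose[OF K0(1)[OF t]
            measurable_measure_prob_algebra[OF A]] dt])
    have law: "K0 t \<omega> \<in> space (prob_algebra ?L)" if "\<omega> \<in> space M" for \<omega>
      using measurable_space[OF K0(1)[OF t]] FM[OF t] that by (simp add: subalgebra_def)
    have gM: "g \<in> borel_measurable M" by (rule measurable_from_subalg[OF FM[OF t] gF])
    have gint: "integrable M g"
    proof (rule integrable_const_bound[of _ 1])
      show "AE \<omega> in M. norm (g \<omega>) \<le> 1"
        using AE_space
      proof eventually_elim
        case (elim \<omega>)
        then interpret K0: prob_space "K0 t \<omega>" using law by (simp add: space_prob_algebra)
        show ?case by (simp add: g_def)
      qed
    qed (rule gM)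
    have "Y t -` B \<inter> space M = {\<omega> \<in> space M. \<omega> \<in> X t -` A (d t \<omega>) \<inter> space M}"
      using measurable_space[OF XM[OF t]] by (auto simp: Y A_def)
    moreover have "AE \<omega> in M. real_cond_exp M ?G
        (indicator {\<omega> \<in> space M. \<omega> \<in> X t -` A (d t \<omega>) \<inter> space M}) \<omega> = measure (K0 t \<omega>) (A (d t \<omega>))"
    proof (rule real_cond_exp_indicator_selected[OF M G, of "{-1, 0, 1}" "d t"
          "\<lambda>i. X t -` A i \<inter> space M" "\<lambda>i \<omega>. measure (K0 t \<omega>) (A i)"])
      show "d t \<in> ?G \<rightarrow>\<^sub>M count_space UNIV" by (rule condX(2)[OF _ t dt]) auto
      show "X t -` A i \<inter> space M \<in> sets M" for i by (rule measurable_sets[OF XM[OF t] A])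
      fix i
      have "AE \<omega> in M. real_cond_exp M ?G (indicator (X t -` A i \<inter> space M)) \<omega> =
          measure (K t \<omega> (HTI T P X t \<omega>)) (A i)"
        using X t A by (auto simp: executes_def)
      then show "AE \<omega> in M. real_cond_exp M ?G (indicator (X t -` A i \<inter> space M)) \<omega> =
          measure (K0 t \<omega>) (A i)"
        using K0(2)[OF t] by eventually_elim simp
    qed (use d(2) in auto)
    ultimately have ce: "AE \<omega> in M. real_cond_exp M ?G (indicator (Y t -` B \<inter> space M)) \<omega> = g \<omega>"
      by (simp add: g_def)
    \<comment> \<open>Tower property: conditioning on \<open>?G\<close> gives \<open>g\<close>,
      which is determined by the market data and so survives conditioning on the smaller
      \<open>?H\<close>.\<close>
    have "AE \<omega> in M. real_cond_exp M ?H (real_cond_exp M ?G (indicator (Y t -` B \<inter> space M))) \<omega> =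
        real_cond_exp M ?H (indicator (Y t -` B \<inter> space M)) \<omega>"
      by (rule H.real_cond_exp_nested_subalg[OF G GH])
        (use measurable_sets[OF YM[OF t] B] in \<open>auto simp: emeasure_eq_measure\<close>)
    moreover have "AE \<omega> in M.
        real_cond_exp M ?H (real_cond_exp M ?G (indicator (Y t -` B \<inter> space M))) \<omega> =
        real_cond_exp M ?H g \<omega>"
      by (rule H.real_cond_exp_cong[OF ce _ gM])
        (rule measurable_from_subalg[OF G borel_measurable_cond_exp])
    moreover have "AE \<omega> in M. real_cond_exp M ?H g \<omega> = g \<omega>"
      by (rule H.real_cond_exp_F_meas[OF gint condY(2)[OF _ t gF]]) auto
    ultimately show ?thesis
      using AE_space
    proof eventually_elim
      case (elim \<omega>)
      have "add_order (d t \<omega>) \<in> K0 t \<omega> \<rightarrow>\<^sub>M ?L" and "space (K0 t \<omega>) = space ?L"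
        using add_order_measurable law[OF elim(4)] measurable_cong_sets[of "K0 t \<omega>" ?L]
          sets_eq_imp_space_eq[of "K0 t \<omega>" ?L]
        by (auto simp: space_prob_algebra)
      then have "measure (K' t \<omega> (HTI T P Y t \<omega>)) B = g \<omega>"
        using B by (simp add: K'[OF t elim(4)] measure_distr g_def A_def)
      then show ?case using elim by simp
    qed
  qed
  then show ?thesis unfolding executes_def using YM fin by blast
qed

subsection \<open>The added trades\<close>

text \<open>\<open>T\<close> may be unbounded below; starting at time 0 leaves finitely many
  observed times before each \<open>t\<close>. The interval excludes \<open>t\<close> because the
  decision uses the position before trading.\<close>

definition market_trade ::
    "real \<Rightarrow> real \<Rightarrow> real set \<Rightarrow> (real \<Rightarrow> 'w \<Rightarrow> real) \<Rightarrow> real \<Rightarrow> 'w \<Rightarrow> int" where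
  "market_trade a b T P t \<omega> =
     (if 0 \<le> t then trade_sign a b (\<lambda>u. P u \<omega>) (T \<inter> {0..<t}) t else 0)"

text \<open>Only fill times are taken from \<open>h\<close>; the prices at those times come from the
  market data.\<close>

definition HTI_trade ::
    "real \<Rightarrow> real \<Rightarrow> real set \<Rightarrow> (real \<Rightarrow> 'w \<Rightarrow> real) \<Rightarrow> real \<Rightarrow> 'w \<Rightarrow> filled_order list \<Rightarrow> int" where
  "HTI_trade a b T P t \<omega> h =
     (if 0 \<le> t then trade_sign a b (\<lambda>u. P u \<omega>) {u \<in> T \<inter> {0..<t}. u \<in> fst ` set h} t else 0)"

text \<open>Every nonzero market-determined trade leaves a fill of \<open>Y\<close>, so the fill
  times contain all trade times, as \<open>holding_trade_times\<close> requires; additional fills do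
  no harm.\<close>

lemma HTI_trade_eq_market_trade:
  assumes T: "trading_times T" and ab: "a \<noteq> b"
    and fin: "finite {u \<in> T. u \<le> t \<and> Y u \<omega> \<noteq> []}"
    and Y: "\<And>u. u \<in> T \<Longrightarrow> market_trade a b T P u \<omega> \<noteq> 0 \<Longrightarrow> Y u \<omega> \<noteq> []"
  shows "HTI_trade a b T P t \<omega> (HTI T P Y t \<omega>) = market_trade a b T P t \<omega>"
proof -
  let ?A = "T \<inter> {0..<t}" and ?h = "HTI T P Y t \<omega>"
  have "holding a b (\<lambda>u. P u \<omega>) {u \<in> ?A. u \<in> fst ` set ?h} \<longleftrightarrow> holding a b (\<lambda>u. P u \<omega>) ?A"
  proof (rule holding_trade_times[OF ab])
    show "finite ?A"
      by (rule finite_subset[OF _ trading_times_finite[OF T, of 0 t]]) auto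
    fix u assume u: "u \<in> ?A" and trade: "trade_sign a b (\<lambda>u. P u \<omega>) (?A \<inter> {..<u}) u \<noteq> 0"
    have "?A \<inter> {..<u} = T \<inter> {0..<u}" using u by auto
    then have "market_trade a b T P u \<omega> \<noteq> 0" using u trade by (simp add: market_trade_def)
    then have "Y u \<omega> \<noteq> []" using Y u by simp
    then obtain s q where "(s, q) \<in> set (Y u \<omega>)" by (cases "Y u \<omega>") auto
    moreover have "finite {v \<in> {v \<in> T. v < t}. Y v \<omega> \<noteq> []}"
      by (rule finite_subset[OF _ fin]) auto
    ultimately have "(u, s, P u \<omega>, q) \<in> set ?h" using u by (simp add: HTI_def set_filled_orders)
    then show "u \<in> {u \<in> ?A. u \<in> fst ` set ?h}" using u by force
  qed auto
  then show ?thesis by (simp add: HTI_trade_def market_trade_def trade_sign_def)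
qed

lemma market_data_measurable:
  assumes "market_data M T F P" "u \<in> T" "t \<in> T" "u \<le> t"
  shows "P u \<in> borel_measurable (F t)"
proof (rule measurable_from_subalg)
  show "subalgebra (F t) (F u)" and "P u \<in> borel_measurable (F u)"
    using assms by (auto simp: market_data_def subalgebra_def)
qed

lemma market_trade_measurable:
  assumes T: "trading_times T" and F: "market_data M T F P" and t: "t \<in> T"
  shows "market_trade a b T P t \<in> F t \<rightarrow>\<^sub>M count_space UNIV"
proof -
  have "finite (T \<inter> {0..<t})"
    by (rule finite_subset[OF _ trading_times_finite[OF T, of 0 t]]) auto
  then have "(\<lambda>\<omega>. trade_sign a b (\<lambda>u. P u \<omega>) {u \<in> T \<inter> {0..<t}. True} t) \<in> F t \<rightarrow>\<^sub>M count_space UNIV"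
    by (rule measurable_trade_sign) (use market_data_measurable[OF F] t in auto)
  moreover have "{u \<in> T \<inter> {0..<t}. True} = T \<inter> {0..<t}" by blast
  ultimately show ?thesis unfolding market_trade_def[abs_def] by (cases "0 \<le> t") simp_all
qed

lemma HTI_trade_measurable:
  assumes T: "trading_times T" and F: "market_data M T F P" and t: "t \<in> T"
  shows "(\<lambda>(\<omega>, h). HTI_trade a b T P t \<omega> h)
    \<in> F t \<Otimes>\<^sub>M list_space filled_order_space \<rightarrow>\<^sub>M count_space UNIV"
proof -
  have "finite (T \<inter> {0..<t})"
    by (rule finite_subset[OF _ trading_times_finite[OF T, of 0 t]]) auto
  then have "(\<lambda>x. trade_sign a b (\<lambda>u. P u (fst x)) {u \<in> T \<inter> {0..<t}. u \<in> fst ` set (snd x)} t)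
      \<in> F t \<Otimes>\<^sub>M list_space filled_order_space \<rightarrow>\<^sub>M count_space UNIV"
  proof (rule measurable_trade_sign)
    show "(\<lambda>x. P u (fst x)) \<in> borel_measurable (F t \<Otimes>\<^sub>M list_space filled_order_space)"
      if "u \<in> insert t (T \<inter> {0..<t})" for u
      using market_data_measurable[OF F _ t, of u] that t
      by (intro measurable_compose[OF measurable_fst]) auto
    show "Measurable.pred (F t \<Otimes>\<^sub>M list_space filled_order_space) (\<lambda>x. u \<in> fst ` set (snd x))" for u
      by (rule measurable_compose[OF measurable_snd fill_time_measurable])
  qed
  then show ?thesis unfolding HTI_trade_def[abs_def] split_beta' by (cases "0 \<le> t") simp_all
qed

text \<open>\<open>uses_HTI\<close> compares rules on possible HTIs only. The actual HTI must be one
  of them before it can be replaced by the empty list.\<close>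

lemma HTI_in_possible_HTI:
  assumes fin: "finite {u \<in> T. u \<le> t \<and> X u \<omega> \<noteq> []}"
    and X: "\<And>u. u \<in> T \<Longrightarrow> X u \<omega> \<in> lists (space order_space)"
    and E: "\<And>u. u \<in> T \<Longrightarrow> X u \<omega> \<noteq> [] \<Longrightarrow> P u \<omega> \<in> E"
  shows "HTI T P X t \<omega> \<in> possible_HTI T P E t \<omega>"
proof -
  have "finite {v \<in> {v \<in> T. v < t}. X v \<omega> \<noteq> []}"
    by (rule finite_subset[OF _ fin]) auto
  note set = set_filled_orders[where X = X and \<omega> = \<omega> and P = P, OF this]
  have sq: "s \<in> {1, -1} \<and> q > 0" if "u \<in> T" "(s, q) \<in> set (X u \<omega>)" for u s q
    using X[OF that(1)] that(2) by (auto simp: in_lists_conv_set space_order_space)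
  have PE: "P u \<omega> \<in> E" if "u \<in> T" "(s, q) \<in> set (X u \<omega>)" for u s q
    by (rule E[OF that(1)]) (use that(2) in force)
  show ?thesis
    unfolding possible_HTI_def HTI_def
  proof (intro CollectI conjI ballI)
    fix x assume "x \<in> set (filled_orders P X {u \<in> T. u < t} \<omega>)"
    then obtain u s q where x: "x = (u, s, P u \<omega>, q)" and u: "u \<in> T" "u < t" "(s, q) \<in> set (X u \<omega>)"
      unfolding set by auto
    then show "case x of (u, s, p, q) \<Rightarrow>
        u \<in> T \<and> u < t \<and> s \<in> {1, -1} \<and> p = P u \<omega> \<and> p \<in> E \<and> q > 0"
      using sq[OF u(1,3)] PE[OF u(1,3)] by simp
  qed (rule sorted_filled_orders)
qed

text \<open>Bounds and starting times may be restricted to natural numbers, which leaves countable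
  operations. Measurability is needed to pass from an almost sure limit to probability 1.\<close>

lemma filterlim_at_top_measurable:
  fixes f :: "real \<Rightarrow> 'w \<Rightarrow> real"
  assumes T: "countable T" and f: "\<And>t. t \<in> T \<Longrightarrow> f t \<in> borel_measurable M"
  shows "Measurable.pred M (\<lambda>\<omega>. filterlim (\<lambda>t. f t \<omega>) at_top (inf at_top (principal T)))"
proof -
  have "filterlim (\<lambda>t. f t \<omega>) at_top (inf at_top (principal T)) \<longleftrightarrow>
      (\<forall>n::nat. \<exists>k::nat. \<forall>t\<in>T. real k \<le> t \<longrightarrow> real n \<le> f t \<omega>)" for \<omega>
  proof
    assume lim: "filterlim (\<lambda>t. f t \<omega>) at_top (inf at_top (principal T))"
    show "\<forall>n::nat. \<exists>k::nat. \<forall>t\<in>T. real k \<le> t \<longrightarrow> real n \<le> f t \<omega>"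
    proof
      fix n :: nat
      obtain x where x: "\<And>t. t \<ge> x \<Longrightarrow> t \<in> T \<Longrightarrow> real n \<le> f t \<omega>"
        using lim unfolding filterlim_at_top eventually_inf_principal eventually_at_top_linorder by blast
      obtain k :: nat where "x \<le> real k" using real_arch_simple by blast
      then show "\<exists>k::nat. \<forall>t\<in>T. real k \<le> t \<longrightarrow> real n \<le> f t \<omega>"
        using x by (intro exI[of _ k]) auto
    qed
  next
    assume *: "\<forall>n::nat. \<exists>k::nat. \<forall>t\<in>T. real k \<le> t \<longrightarrow> real n \<le> f t \<omega>"
    show "filterlim (\<lambda>t. f t \<omega>) at_top (inf at_top (principal T))"
      unfolding filterlim_at_top eventually_inf_principal eventually_at_top_linorder
    proof
      fix c :: real
      obtain n :: nat where "c \<le> real n" using real_arch_simple by blast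
      moreover obtain k :: nat where "\<forall>t\<in>T. real k \<le> t \<longrightarrow> real n \<le> f t \<omega>" using * by blast
      ultimately show "\<exists>x. \<forall>t\<ge>x. t \<in> T \<longrightarrow> c \<le> f t \<omega>"
        by (intro exI[of _ "real k"]) (auto intro: order_trans)
    qed
  qed
  moreover have "Measurable.pred M (\<lambda>\<omega>. \<forall>t\<in>T. real k \<le> t \<longrightarrow> real n \<le> f t \<omega>)" for k n :: nat
    unfolding pred_def
  proof (rule sets.sets_Collect_countable_All')
    fix t assume "t \<in> T"
    note f[OF this, measurable]
    show "{\<omega> \<in> space M. real k \<le> t \<longrightarrow> real n \<le> f t \<omega>} \<in> sets M" by simp
  qed (rule T)
  ultimately show ?thesis by simp
qed

theorem mainTheorem1:
  fixes M :: "'w measure" and T :: "real set" and F :: "real \<Rightarrow> 'w measure"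
    and P :: "real \<Rightarrow> 'w \<Rightarrow> real" and \<delta> :: real and \<Gamma> E :: "real set" and m :: real
    and S :: "'w rule" and X :: "real \<Rightarrow> 'w \<Rightarrow> order list"
  assumes "prob_space M"
    and "trading_times T"
    and "market_data M T F P"
    and "tick_grid \<delta> \<Gamma>"
    and "price_process M T P \<Gamma> E"
    and "m > 0"
    and "trading_strategy M T F P E S X"
    and "\<not> uses_HTI M T P E S"
  shows "\<exists>S' X'.
    trading_strategy M T F P E S' X' \<and>
    uses_HTI M T P E S' \<and>
    \<P>(\<omega> in M. filterlim (\<lambda>t. PnL m T P X' t \<omega> - PnL m T P X t \<omega>) at_top
                 (inf at_top (principal T))) = 1"
proof -
  interpret prob_space M by fact
  note T = \<open>trading_times T\<close> and F = \<open>market_data M T F P\<close> and proc = \<open>price_process M T P \<Gamma> E\<close>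
  let ?L = "list_space order_space"
  let ?H = "list_space filled_order_space"
  have rule: "trading_rule T F S" and exec: "executes M T F P S X"
    and XE: "\<And>t \<omega>. t \<in> T \<Longrightarrow> \<omega> \<in> space M \<Longrightarrow> X t \<omega> \<noteq> [] \<Longrightarrow> P t \<omega> \<in> E"
    and fill: "AE \<omega> in M. \<exists>t\<in>T. X t \<omega> \<noteq> []"
    using \<open>trading_strategy M T F P E S X\<close> by (auto simp: trading_strategy_def)
  have XM: "X t \<in> M \<rightarrow>\<^sub>M ?L" if "t \<in> T" for t
    using exec that by (auto simp: executes_def)
  have finX: "finite {u \<in> T. u \<le> t \<and> X u \<omega> \<noteq> []}" if "t \<in> T" "\<omega> \<in> space M" for t \<omega>
    using exec that by (auto simp: executes_def)
  have spF: "space (F t) = space M" if "t \<in> T" for t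
    using F that by (auto simp: market_data_def subalgebra_def)
  have \<Gamma>: "finite \<Gamma>" "\<And>x. x \<in> \<Gamma> \<Longrightarrow> x > 0" and E\<Gamma>: "E \<subseteq> \<Gamma>"
    and P\<Gamma>: "\<And>t \<omega>. t \<in> T \<Longrightarrow> \<omega> \<in> space M \<Longrightarrow> P t \<omega> \<in> \<Gamma>"
    using \<open>tick_grid \<delta> \<Gamma>\<close> proc by (auto simp: tick_grid_def price_process_def)
  have finE: "finite E" using \<Gamma> E\<Gamma> finite_subset by blast
  have visit: "AE \<omega> in M. \<exists>t\<in>T. P t \<omega> \<in> E"
    using fill AE_space by eventually_elim (use XE in blast)
  \<comment> \<open>The original strategy almost surely has a fill, and fills happen at prices in
    \<open>E\<close>.\<close>
  have E: "E \<noteq> {}"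
  proof
    assume "E = {}"
    then have "AE \<omega> in M. False" using visit by simp
    then show False by simp
  qed
  define a b where "a = Min E" and "b = Max E"
  have aE: "a \<in> E" and bE: "b \<in> E" using finE E by (simp_all add: a_def b_def)
  have ab: "a < b"
  proof -
    have "(\<exists>\<xi>. up_threshold E a \<xi>) \<or> (\<exists>\<zeta>. down_threshold E a \<zeta>)"
      using proc aE by (auto simp: price_process_def)
    then obtain \<xi> where "\<xi> > 0" "a + \<xi> \<in> E"
      using Min_has_up_threshold[OF finE E] by (auto simp: a_def up_threshold_def)
    then show ?thesis using Max_ge[OF finE] by (fastforce simp: b_def)
  qed
  have recur: "AE \<omega> in M. \<forall>x. (\<exists>u\<in>T. x < u \<and> P u \<omega> = a) \<and> (\<exists>u\<in>T. x < u \<and> P u \<omega> = b)"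
    using AE_extreme_prices_recur[OF \<open>prob_space M\<close> T finE E proc] visit
    unfolding a_def b_def by eventually_elim blast

  define d where "d = market_trade a b T P"
  define Y where "Y t \<omega> = add_order (d t \<omega>) (X t \<omega>)" for t \<omega>
  \<comment> \<open>The empty HTI is always possible, and almost surely every other possible HTI
    gives the same law, so \<open>S t \<omega> []\<close> represents the original law without
    reference to fills.\<close>
  define S' where "S' t \<omega> h = distr (S t \<omega> []) ?L (add_order (HTI_trade a b T P t \<omega> h))" for t \<omega> h
  have d_cases: "d t \<omega> \<in> {-1, 0, 1}" for t \<omega>
    using trade_sign_cases by (auto simp: d_def market_trade_def)
  have d_neg: "d t \<omega> = 0" if "t < 0" for t \<omega>
    using that by (simp add: d_def market_trade_def)
  have Y_Nil: "Y t \<omega> = [] \<longleftrightarrow> d t \<omega> = 0 \<and> X t \<omega> = []" for t \<omega>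
    using d_cases[of t \<omega>] by (auto simp: Y_def add_order_def)
  have finY: "finite {u \<in> T. u \<le> t \<and> Y u \<omega> \<noteq> []}" if "t \<in> T" "\<omega> \<in> space M" for t \<omega>
  proof (rule finite_subset)
    show "{u \<in> T. u \<le> t \<and> Y u \<omega> \<noteq> []} \<subseteq> {u \<in> T. u \<le> t \<and> X u \<omega> \<noteq> []} \<union> (T \<inter> {0..t})"
      using d_neg by (force simp: Y_Nil not_less)
  qed (use finX[OF that] trading_times_finite[OF T] in auto)
  have nil: "[] \<in> space ?H" by simp
  have law: "(\<lambda>\<omega>. S t \<omega> []) \<in> F t \<rightarrow>\<^sub>M prob_algebra ?L" if "t \<in> T" for t
  proof -
    have "(\<lambda>\<omega>. (\<omega>, [])) \<in> F t \<rightarrow>\<^sub>M F t \<Otimes>\<^sub>M ?H"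
      using nil by (intro measurable_Pair) auto
    then show ?thesis
      using rule that measurable_compose unfolding trading_rule_def by fastforce
  qed
  have law_space: "S t \<omega> [] \<in> space (prob_algebra ?L)" if "t \<in> T" "\<omega> \<in> space M" for t \<omega>
    using measurable_space[OF law[OF that(1)]] spF[OF that(1)] that(2) by simp
  have HTI_free: "AE \<omega> in M. S t \<omega> (HTI T P X t \<omega>) = S t \<omega> []" if t: "t \<in> T" for t
  proof -
    have "AE \<omega> in M. \<forall>h\<in>possible_HTI T P E t \<omega>. \<forall>h'\<in>possible_HTI T P E t \<omega>. S t \<omega> h = S t \<omega> h'"
      using \<open>\<not> uses_HTI M T P E S\<close> t by (auto simp: uses_HTI_def)
    then show ?thesis
      using AE_space
    proof eventually_elim
      case (elim \<omega>)
      have "HTI T P X t \<omega> \<in> possible_HTI T P E t \<omega>"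
        using measurable_space[OF XM] XE elim(2)
        by (intro HTI_in_possible_HTI finX[OF t elim(2)]) auto
      moreover have "[] \<in> possible_HTI T P E t \<omega>" by (simp add: possible_HTI_def)
      ultimately show ?case using elim(1) by blast
    qed
  qed
  have own: "S' t \<omega> (HTI T P Y t \<omega>) = distr (S t \<omega> []) ?L (add_order (d t \<omega>))"
    if "t \<in> T" "\<omega> \<in> space M" for t \<omega>
    using ab that finY HTI_trade_eq_market_trade[OF T, of a b t Y \<omega> P]
    by (auto simp: S'_def Y_Nil d_def)

  have "trading_strategy M T F P E S' Y"
    unfolding trading_strategy_def
  proof (intro conjI ballI impI)
    show "trading_rule T F S'"
      unfolding trading_rule_def
    proof
      fix t assume t: "t \<in> T"
      have "(\<lambda>x. S t (fst x) []) \<in> F t \<Otimes>\<^sub>M ?H \<rightarrow>\<^sub>M prob_algebra ?L"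
        by (rule measurable_compose[OF measurable_fst law[OF t]])
      from measurable_distr_add_order[OF HTI_trade_measurable[OF T F t] this]
      show "(\<lambda>(\<omega>, h). S' t \<omega> h) \<in> F t \<Otimes>\<^sub>M ?H \<rightarrow>\<^sub>M prob_algebra ?L"
        by (simp add: S'_def split_beta')
    qed
    show "executes M T F P S' Y"
    proof (rule executes_add_order[where ?K0.0 = "\<lambda>t \<omega>. S t \<omega> []" and d = d])
      show "d t \<in> F t \<rightarrow>\<^sub>M count_space UNIV" if "t \<in> T" for t
        unfolding d_def by (rule market_trade_measurable[OF T F that])
    qed (fact \<open>prob_space M\<close> F exec law HTI_free d_cases Y_def finY own)+
    show "P t \<omega> \<in> E" if "t \<in> T" "\<omega> \<in> space M" "Y t \<omega> \<noteq> []" for t \<omega>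
      using that XE[of t \<omega>] aE bE
      by (auto simp: Y_Nil d_def market_trade_def trade_sign_def split: if_splits)
    show "AE \<omega> in M. \<exists>t\<in>T. Y t \<omega> \<noteq> []"
      using fill by eventually_elim (auto simp: Y_Nil)
  qed
  moreover have "uses_HTI M T P E S'"
  proof (rule ccontr)
    assume "\<not> uses_HTI M T P E S'"
    then have "AE \<omega> in M. \<forall>t\<in>T. \<forall>h\<in>possible_HTI T P E t \<omega>. \<forall>h'\<in>possible_HTI T P E t \<omega>.
        S' t \<omega> h = S' t \<omega> h'"
      unfolding AE_ball_countable[OF trading_times_countable[OF T]] by (simp add: uses_HTI_def)
    then have "AE \<omega> in M. False"
      using recur AE_space
    proof eventually_elim
      case (elim \<omega>)
      obtain v where "v \<in> sale_times a b (\<lambda>u. P u \<omega>) (T \<inter> {0..})"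
        using sale_times_unbounded[OF T, of a b "\<lambda>u. P u \<omega>" 0] ab elim(2) by auto
      then obtain u where v: "v \<in> T" "P v \<omega> = b" and u: "u \<in> T" "0 \<le> u" "u < v" "P u \<omega> = a"
        by (auto simp: sale_times_def holding_def)
      \<comment> \<open>A fill at \<open>u\<close>, when the price was \<open>a\<close>, makes the
        rule sell at \<open>v\<close>. With no fills it sees no open unit and, the price being
        \<open>b\<close>, adds nothing. These two possible HTIs give different laws.\<close>
      let ?h = "[(u, -1, a, 1)]"
      have "[] \<in> possible_HTI T P E v \<omega>" "?h \<in> possible_HTI T P E v \<omega>"
        using u aE by (auto simp: possible_HTI_def)
      then have "S' v \<omega> [] = S' v \<omega> ?h" using elim(1) v by blast
      moreover have "HTI_trade a b T P v \<omega> [] = 0" "HTI_trade a b T P v \<omega> ?h = 1"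
        using u v ab by (auto simp: HTI_trade_def trade_sign_def holding_def)
      ultimately show False
        using add_order_law_neq[OF law_space[OF v(1) elim(3)]] by (simp add: S'_def)
    qed
    then show False by simp
  qed
  moreover have "\<P>(\<omega> in M. filterlim (\<lambda>t. PnL m T P Y t \<omega> - PnL m T P X t \<omega>) at_top
      (inf at_top (principal T))) = 1"
  proof -
    define gain where "gain t \<omega> = m * (\<Sum>u\<in>T \<inter> {0..t}. of_int (d u \<omega>) * (P u \<omega> - P t \<omega>))" for t \<omega>
    have "PnL m T P Y t \<omega> - PnL m T P X t \<omega> = gain t \<omega>" if "t \<in> T" "\<omega> \<in> space M" for t \<omega>
    proof -
      have "PnL m T P Y t \<omega> = PnL m T P X t \<omega> + gain t \<omega>"
        unfolding gain_def
      proof (rule PnL_add_order)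
        show "d u \<omega> = 0" if "u \<in> T" "u \<le> t" "u \<notin> T \<inter> {0..t}" for u
          using that by (intro d_neg) auto
      qed (use finX[OF that] trading_times_finite[OF T] d_cases in \<open>auto simp: Y_def\<close>)
      then show ?thesis by simp
    qed
    \<comment> \<open>The filter sees only times in \<open>T\<close>, so the profit difference may
      be replaced by \<open>gain\<close>, a finite sum whose measurability is immediate.\<close>
    then have lim_eq: "filterlim (\<lambda>t. PnL m T P Y t \<omega> - PnL m T P X t \<omega>) at_top
          (inf at_top (principal T)) \<longleftrightarrow>
        filterlim (\<lambda>t. gain t \<omega>) at_top (inf at_top (principal T))" if "\<omega> \<in> space M" for \<omega>
      using that by (intro filterlim_cong) (auto simp: eventually_inf_principal)
    have "d t \<in> M \<rightarrow>\<^sub>M count_space UNIV" if "t \<in> T" for t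
      unfolding d_def using F that
      by (intro measurable_from_subalg[OF _ market_trade_measurable[OF T F that]])
        (auto simp: market_data_def)
    then have dM: "(\<lambda>\<omega>. real_of_int (d t \<omega>)) \<in> borel_measurable M" if "t \<in> T" for t
      using that by (intro measurable_compose[where f = "d t" and g = real_of_int]) auto
    have PM: "P t \<in> borel_measurable M" if "t \<in> T" for t
      using proc that by (auto simp: price_process_def)
    have gainM: "gain t \<in> borel_measurable M" if "t \<in> T" for t
      unfolding gain_def using that
      by (intro borel_measurable_times borel_measurable_const borel_measurable_sum
          borel_measurable_diff dM PM) auto
    have "AE \<omega> in M. filterlim (\<lambda>t. gain t \<omega>) at_top (inf at_top (principal T))"
      using recur AE_space
    proof eventually_elim
      case (elim \<omega>)
      have "gain t \<omega> = m * (\<Sum>u\<in>T \<inter> {0..t}.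
          of_int (trade_sign a b (\<lambda>u. P u \<omega>) (T \<inter> {0..t} \<inter> {..<u}) u) * (P u \<omega> - P t \<omega>))" for t
      proof -
        have "d u \<omega> = trade_sign a b (\<lambda>u. P u \<omega>) (T \<inter> {0..t} \<inter> {..<u}) u"
          if "u \<in> T \<inter> {0..t}" for u
        proof -
          have "T \<inter> {0..t} \<inter> {..<u} = T \<inter> {0..<u}" using that by auto
          then show ?thesis using that by (simp add: d_def market_trade_def)
        qed
        then have "(\<Sum>u\<in>T \<inter> {0..t}. of_int (d u \<omega>) * (P u \<omega> - P t \<omega>)) = (\<Sum>u\<in>T \<inter> {0..t}.
            of_int (trade_sign a b (\<lambda>u. P u \<omega>) (T \<inter> {0..t} \<inter> {..<u}) u) * (P u \<omega> - P t \<omega>))"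
          by (intro sum.cong[OF refl]) simp
        then show ?thesis by (simp only: gain_def)
      qed
      moreover have "0 \<le> a" "\<And>t. t \<in> T \<Longrightarrow> 0 \<le> P t \<omega>"
        using \<Gamma>(2) P\<Gamma>[OF _ elim(2)] aE E\<Gamma> by (auto intro!: less_imp_le)
      ultimately show ?case
        using trade_profit_filterlim[OF T ab \<open>m > 0\<close>, of "\<lambda>u. P u \<omega>"] elim(1) by simp
    qed
    then have "AE \<omega> in M. filterlim (\<lambda>t. PnL m T P Y t \<omega> - PnL m T P X t \<omega>) at_top
        (inf at_top (principal T))"
      using AE_space by eventually_elim (simp add: lim_eq)
    moreover have "{\<omega> \<in> space M. filterlim (\<lambda>t. PnL m T P Y t \<omega> - PnL m T P X t \<omega>) at_top
        (inf at_top (principal T))} \<in> sets M"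
    proof -
      have "{\<omega> \<in> space M. filterlim (\<lambda>t. PnL m T P Y t \<omega> - PnL m T P X t \<omega>) at_top
            (inf at_top (principal T))} =
          {\<omega> \<in> space M. filterlim (\<lambda>t. gain t \<omega>) at_top (inf at_top (principal T))}"
        using lim_eq by blast
      then show ?thesis
        using filterlim_at_top_measurable[OF trading_times_countable[OF T] gainM]
        by (simp add: pred_def)
    qed
    ultimately show ?thesis by (simp add: prob_Collect_eq_1)
  qed
  ultimately show ?thesis by blast
qed

end
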